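(* Let $U$ be a universe. There is an equivalence between the category $LW(U)$ of Lawvere theories in $U$ and the category $RMon(Jf_U)$ of $Jf_U$-relative monads; that is, there are functors $R:RMon(Jf_U)\to LW(U)$ and $S:LW(U)\to RMon(Jf_U)$ and isomorphisms of functors $R\circ S\to Id_{RMon(Jf_U)}$ and $S\circ R\to Id_{LW(U)}$.
   Context: Compositions, of morphisms and of functors, are written in diagrammatic order: for $f:X\to Y$ and $g:Y\to Z$, $f\circ g:X\to Z$ means first $f$, then $g$. $U$ is a Grothendieck universe with $\mathbb{N}\in U$. $Sets(U)$ is the category whose objects are the elements of $U$ and whose morphisms are all functions between them. For $n\in\mathbb{N}$, $stn(n)=\{i\in\mathbb{N}\mid i<n\}$. $F$ is the category with set of objects $\mathbb{N}$ and $Mor_F(m,n)=Fun(stn(m),stn(n))$ (the set of all functions). $Jf_U:F\to Sets(U)$ is the functor taking $n$ to $stn(n)$ and each function to itself. For a functor $J:C\to D$, a relative monad on $J$ (a $J$-relative monad) is a triple $\mathbf{RR}=(RR,\eta,\rho)$ consisting of a function $RR:Ob(C)\to Ob(D)$, a morphism $\eta(X):J(X)\to RR(X)$ for each $X\in C$, and for each $X,Y\in C$ and $f:J(X)\to RR(Y)$ a morphism $\rho(f):RR(X)\to RR(Y)$, such that (1) $\rho(\eta(X))=Id_{RR(X)}$; (2) $\eta(X)\circ\rho(f)=f$ for every $f:J(X)\to RR(Y)$; (3) $\rho(f)\circ\rho(g)=\rho(f\circ\rho(g))$ for all $f:J(X)\to RR(Y)$, $g:J(Y)\to RR(Z)$.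 A morphism $\phi:(RR,\eta,\rho)\to(RR',\eta',\rho')$ is a family of morphisms $\phi(X):RR(X)\to RR'(X)$, $X\in C$, such that $\eta'(X)=\eta(X)\circ\phi(X)$ for all $X$, and $\rho(f)\circ\phi(Y)=\phi(X)\circ\rho'(f\circ\phi(Y))$ for every $f:J(X)\to RR(Y)$. With objectwise identities and compositions these form the category $RMon(J)$. For $m,n\in\mathbb{N}$, $ii_0^{m,n}:stn(m)\to stn(m+n)$, $j\mapsto j$, and $ii_1^{m,n}:stn(n)\to stn(m+n)$, $j\mapsto m+j$, are the injections of the initial segment of length $m$ and the final segment of length $n$. A Lawvere theory is a pair $(T,L)$ of a category $T$ and a functor $L:F\to T$ such that $L$ is a bijection on objects, $L(0)$ is an initial object of $T$, and for all $m,n$ the commutative square with maps $L(0)\to L(m)$, $L(0)\to L(n)$, $L(ii_0^{m,n}):L(m)\to L(m+n)$, $L(ii_1^{m,n}):L(n)\to L(m+n)$ is a push-out square. A morphism $G:(T,L)\to(T',L')$ of Lawvere theories is a functor $G:T\to T'$ with $L\circ G=L'$ (strict equality). A Lawvere theory in $U$ is one for which the sets of objects and of morphisms of $T$ are elements of $U$; $LW(U)$ is the category of Lawvere theories in $U$ and their morphisms. *)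

theory Defs
  imports "HOL-Library.FuncSet"
begin

section \<open>Categories, functors, natural isomorphisms\<close>

text \<open>
  All structures below are extensional: operations take the value \<open>undefined\<close> outside their
  domain, so that HOL equality of categories, functors and relative monads is equality of the
  mathematical objects. Composition is in diagrammatic order: \<open>Comp C f g\<close> is first \<open>f\<close>, then \<open>g\<close>.
\<close>

record ('o, 'm) cat =
  Ob :: "'o set"
  Mor :: "'m set"
  Src :: "'m \<Rightarrow> 'o"
  Tgt :: "'m \<Rightarrow> 'o"
  Ident :: "'o \<Rightarrow> 'm"
  Comp :: "'m \<Rightarrow> 'm \<Rightarrow> 'm"

definition Hom :: "('o, 'm) cat \<Rightarrow> 'o \<Rightarrow> 'o \<Rightarrow> 'm set" where
  "Hom C X Y = {f \<in> Mor C. Src C f = X \<and> Tgt C f = Y}"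

definition is_category :: "('o, 'm) cat \<Rightarrow> bool" where
  "is_category C \<longleftrightarrow>
     Src C \<in> Mor C \<rightarrow>\<^sub>E Ob C \<and> Tgt C \<in> Mor C \<rightarrow>\<^sub>E Ob C \<and>
     Ident C \<in> extensional (Ob C) \<and>
     (\<forall>X\<in>Ob C. Ident C X \<in> Hom C X X) \<and>
     (\<forall>f g. f \<in> Mor C \<and> g \<in> Mor C \<and> Tgt C f = Src C g
        \<longrightarrow> Comp C f g \<in> Hom C (Src C f) (Tgt C g)) \<and>
     (\<forall>f g. \<not> (f \<in> Mor C \<and> g \<in> Mor C \<and> Tgt C f = Src C g) \<longrightarrow> Comp C f g = undefined) \<and>
     (\<forall>f\<in>Mor C. Comp C (Ident C (Src C f)) f = f \<and> Comp C f (Ident C (Tgt C f)) = f) \<and>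
     (\<forall>f\<in>Mor C. \<forall>g\<in>Mor C. \<forall>h\<in>Mor C. Tgt C f = Src C g \<and> Tgt C g = Src C h
        \<longrightarrow> Comp C (Comp C f g) h = Comp C f (Comp C g h))"

record ('o, 'm, 'p, 'n) fnct =
  FOb :: "'o \<Rightarrow> 'p"
  FMor :: "'m \<Rightarrow> 'n"

definition is_functor :: "('o, 'm) cat \<Rightarrow> ('p, 'n) cat \<Rightarrow> ('o, 'm, 'p, 'n) fnct \<Rightarrow> bool" where
  "is_functor C D \<Phi> \<longleftrightarrow>
     is_category C \<and> is_category D \<and>
     FOb \<Phi> \<in> Ob C \<rightarrow>\<^sub>E Ob D \<and> FMor \<Phi> \<in> extensional (Mor C) \<and>
     (\<forall>f\<in>Mor C. FMor \<Phi> f \<in> Hom D (FOb \<Phi> (Src C f)) (FOb \<Phi> (Tgt C f))) \<and>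
     (\<forall>X\<in>Ob C. FMor \<Phi> (Ident C X) = Ident D (FOb \<Phi> X)) \<and>
     (\<forall>f\<in>Mor C. \<forall>g\<in>Mor C. Tgt C f = Src C g
        \<longrightarrow> FMor \<Phi> (Comp C f g) = Comp D (FMor \<Phi> f) (FMor \<Phi> g))"

definition functor_id :: "('o, 'm) cat \<Rightarrow> ('o, 'm, 'o, 'm) fnct" where
  "functor_id C = \<lparr>FOb = (\<lambda>X\<in>Ob C. X), FMor = (\<lambda>f\<in>Mor C. f)\<rparr>"

text \<open>First \<open>\<Phi>\<close>, then \<open>\<Psi>\<close>; \<open>C\<close> is the source of \<open>\<Phi>\<close>.\<close>

definition functor_comp ::
  "('o, 'm) cat \<Rightarrow> ('o, 'm, 'p, 'n) fnct \<Rightarrow> ('p, 'n, 'q, 'k) fnct \<Rightarrow> ('o, 'm, 'q, 'k) fnct" where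
  "functor_comp C \<Phi> \<Psi> =
     \<lparr>FOb = (\<lambda>X\<in>Ob C. FOb \<Psi> (FOb \<Phi> X)), FMor = (\<lambda>f\<in>Mor C. FMor \<Psi> (FMor \<Phi> f))\<rparr>"

definition nat_trans ::
  "('o, 'm) cat \<Rightarrow> ('p, 'n) cat \<Rightarrow> ('o, 'm, 'p, 'n) fnct \<Rightarrow> ('o, 'm, 'p, 'n) fnct
     \<Rightarrow> ('o \<Rightarrow> 'n) \<Rightarrow> bool" where
  "nat_trans C D \<Phi> \<Psi> \<alpha> \<longleftrightarrow>
     is_functor C D \<Phi> \<and> is_functor C D \<Psi> \<and> \<alpha> \<in> extensional (Ob C) \<and>
     (\<forall>X\<in>Ob C. \<alpha> X \<in> Hom D (FOb \<Phi> X) (FOb \<Psi> X)) \<and>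
     (\<forall>f\<in>Mor C. Comp D (FMor \<Phi> f) (\<alpha> (Tgt C f)) = Comp D (\<alpha> (Src C f)) (FMor \<Psi> f))"

definition functor_iso ::
  "('o, 'm) cat \<Rightarrow> ('p, 'n) cat \<Rightarrow> ('o, 'm, 'p, 'n) fnct \<Rightarrow> ('o, 'm, 'p, 'n) fnct
     \<Rightarrow> ('o \<Rightarrow> 'n) \<Rightarrow> bool" where
  "functor_iso C D \<Phi> \<Psi> \<alpha> \<longleftrightarrow>
     nat_trans C D \<Phi> \<Psi> \<alpha> \<and>
     (\<exists>\<beta>. nat_trans C D \<Psi> \<Phi> \<beta> \<and>
        (\<forall>X\<in>Ob C. Comp D (\<alpha> X) (\<beta> X) = Ident D (FOb \<Phi> X) \<and>
                  Comp D (\<beta> X) (\<alpha> X) = Ident D (FOb \<Psi> X)))"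

definition is_initial :: "('o, 'm) cat \<Rightarrow> 'o \<Rightarrow> bool" where
  "is_initial C I \<longleftrightarrow> I \<in> Ob C \<and> (\<forall>X\<in>Ob C. \<exists>!f. f \<in> Hom C I X)"

definition initial_arrow :: "('o, 'm) cat \<Rightarrow> 'o \<Rightarrow> 'o \<Rightarrow> 'm" where
  "initial_arrow C I X = (THE f. f \<in> Hom C I X)"

text \<open>The square \<open>f : A \<rightarrow> B\<close>, \<open>g : A \<rightarrow> B'\<close>, \<open>h : B \<rightarrow> P\<close>, \<open>k : B' \<rightarrow> P\<close>.\<close>

definition is_pushout :: "('o, 'm) cat \<Rightarrow> 'm \<Rightarrow> 'm \<Rightarrow> 'm \<Rightarrow> 'm \<Rightarrow> bool" where
  "is_pushout C f g h k \<longleftrightarrow>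
     (\<exists>A B B' P.
        f \<in> Hom C A B \<and> g \<in> Hom C A B' \<and> h \<in> Hom C B P \<and> k \<in> Hom C B' P \<and>
        Comp C f h = Comp C g k \<and>
        (\<forall>Q\<in>Ob C. \<forall>u \<in> Hom C B Q. \<forall>v \<in> Hom C B' Q. Comp C f u = Comp C g v
           \<longrightarrow> (\<exists>!w. w \<in> Hom C P Q \<and> Comp C h w = u \<and> Comp C k w = v)))"

text \<open>
  The category with object set \<open>B\<close> whose morphisms from \<open>X\<close> to \<open>Y\<close> are the triples \<open>(X, Y, f)\<close> with
  \<open>f \<in> H X Y\<close>. Identities are given by \<open>i\<close>; \<open>c X f g\<close> is the composite, first \<open>f\<close> and then \<open>g\<close>,
  where \<open>X\<close> is the source of \<open>f\<close>.
\<close>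

definition hom_cat ::
  "'o set \<Rightarrow> ('o \<Rightarrow> 'o \<Rightarrow> 'a set) \<Rightarrow> ('o \<Rightarrow> 'a) \<Rightarrow> ('o \<Rightarrow> 'a \<Rightarrow> 'a \<Rightarrow> 'a)
     \<Rightarrow> ('o, 'o \<times> 'o \<times> 'a) cat" where
  "hom_cat B H i c =
     (let M = {(X, Y, f). X \<in> B \<and> Y \<in> B \<and> f \<in> H X Y} in
      \<lparr>Ob = B,
       Mor = M,
       Src = (\<lambda>a\<in>M. fst a),
       Tgt = (\<lambda>a\<in>M. fst (snd a)),
       Ident = (\<lambda>X\<in>B. (X, X, i X)),
       Comp = (\<lambda>a b. if a \<in> M \<and> b \<in> M \<and> fst (snd a) = fst b
                     then (fst a, fst (snd b), c (fst a) (snd (snd a)) (snd (snd b)))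
                     else undefined)\<rparr>)"

text \<open>Objects \<open>B\<close>, and as morphisms from \<open>X\<close> to \<open>Y\<close> all functions between the sets \<open>S X\<close> and \<open>S Y\<close>.\<close>

definition fun_cat ::
  "'o set \<Rightarrow> ('o \<Rightarrow> 'a set) \<Rightarrow> ('o, 'o \<times> 'o \<times> ('a \<Rightarrow> 'a)) cat" where
  "fun_cat B S =
     hom_cat B (\<lambda>X Y. S X \<rightarrow>\<^sub>E S Y) (\<lambda>X. \<lambda>x\<in>S X. x) (\<lambda>X f g. compose (S X) g f)"


section \<open>Relative monads\<close>

text \<open>
  \<open>rho M X Y f\<close> carries the objects \<open>X\<close> and \<open>Y\<close> explicitly, since they are not determined by the
  morphism \<open>f : J X \<rightarrow> RR Y\<close> alone.
\<close>

record ('oc, 'od, 'md) rmon =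
  RR :: "'oc \<Rightarrow> 'od"
  eta :: "'oc \<Rightarrow> 'md"
  rho :: "'oc \<Rightarrow> 'oc \<Rightarrow> 'md \<Rightarrow> 'md"

definition relative_monad ::
  "('oc, 'mc) cat \<Rightarrow> ('od, 'md) cat \<Rightarrow> ('oc, 'mc, 'od, 'md) fnct
     \<Rightarrow> ('oc, 'od, 'md) rmon \<Rightarrow> bool" where
  "relative_monad C D J M \<longleftrightarrow>
     is_functor C D J \<and>
     RR M \<in> Ob C \<rightarrow>\<^sub>E Ob D \<and>
     eta M \<in> extensional (Ob C) \<and>
     (\<forall>X\<in>Ob C. eta M X \<in> Hom D (FOb J X) (RR M X)) \<and>
     (\<forall>X\<in>Ob C. \<forall>Y\<in>Ob C. \<forall>f \<in> Hom D (FOb J X) (RR M Y).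
        rho M X Y f \<in> Hom D (RR M X) (RR M Y)) \<and>
     (\<forall>X Y f. \<not> (X \<in> Ob C \<and> Y \<in> Ob C \<and> f \<in> Hom D (FOb J X) (RR M Y))
        \<longrightarrow> rho M X Y f = undefined) \<and>
     (\<forall>X\<in>Ob C. rho M X X (eta M X) = Ident D (RR M X)) \<and>
     (\<forall>X\<in>Ob C. \<forall>Y\<in>Ob C. \<forall>f \<in> Hom D (FOb J X) (RR M Y).
        Comp D (eta M X) (rho M X Y f) = f) \<and>
     (\<forall>X\<in>Ob C. \<forall>Y\<in>Ob C. \<forall>Z\<in>Ob C.
        \<forall>f \<in> Hom D (FOb J X) (RR M Y). \<forall>g \<in> Hom D (FOb J Y) (RR M Z).
          Comp D (rho M X Y f) (rho M Y Z g) = rho M X Z (Comp D f (rho M Y Z g)))"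

definition rmon_morphism ::
  "('oc, 'mc) cat \<Rightarrow> ('od, 'md) cat \<Rightarrow> ('oc, 'mc, 'od, 'md) fnct
     \<Rightarrow> ('oc, 'od, 'md) rmon \<Rightarrow> ('oc, 'od, 'md) rmon \<Rightarrow> ('oc \<Rightarrow> 'md) \<Rightarrow> bool" where
  "rmon_morphism C D J M M' \<phi> \<longleftrightarrow>
     \<phi> \<in> extensional (Ob C) \<and>
     (\<forall>X\<in>Ob C. \<phi> X \<in> Hom D (RR M X) (RR M' X)) \<and>
     (\<forall>X\<in>Ob C. eta M' X = Comp D (eta M X) (\<phi> X)) \<and>
     (\<forall>X\<in>Ob C. \<forall>Y\<in>Ob C. \<forall>f \<in> Hom D (FOb J X) (RR M Y).
        Comp D (rho M X Y f) (\<phi> Y) = Comp D (\<phi> X) (rho M' X Y (Comp D f (\<phi> Y))))"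

definition RMon ::
  "('oc, 'mc) cat \<Rightarrow> ('od, 'md) cat \<Rightarrow> ('oc, 'mc, 'od, 'md) fnct
     \<Rightarrow> (('oc, 'od, 'md) rmon,
         ('oc, 'od, 'md) rmon \<times> ('oc, 'od, 'md) rmon \<times> ('oc \<Rightarrow> 'md)) cat" where
  "RMon C D J =
     hom_cat {M. relative_monad C D J M}
       (\<lambda>M M'. {\<phi>. rmon_morphism C D J M M' \<phi>})
       (\<lambda>M. \<lambda>X\<in>Ob C. Ident D (RR M X))
       (\<lambda>M \<phi> \<psi>. \<lambda>X\<in>Ob C. Comp D (\<phi> X) (\<psi> X))"


section \<open>Lawvere theories\<close>

definition stn :: "nat \<Rightarrow> nat set" where
  "stn n = {i. i < n}"

type_synonym fmor = "nat \<times> nat \<times> (nat \<Rightarrow> nat)"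

definition FF :: "(nat, fmor) cat" where
  "FF = fun_cat UNIV stn"

definition ii0 :: "nat \<Rightarrow> nat \<Rightarrow> fmor" where
  "ii0 m n = (m, m + n, \<lambda>j\<in>stn m. j)"

definition ii1 :: "nat \<Rightarrow> nat \<Rightarrow> fmor" where
  "ii1 m n = (n, m + n, \<lambda>j\<in>stn n. m + j)"

definition lawvere_theory :: "('o, 'm) cat \<Rightarrow> (nat, fmor, 'o, 'm) fnct \<Rightarrow> bool" where
  "lawvere_theory T L \<longleftrightarrow>
     is_category T \<and> is_functor FF T L \<and>
     bij_betw (FOb L) (Ob FF) (Ob T) \<and>
     is_initial T (FOb L 0) \<and>
     (\<forall>m n. is_pushout T
        (initial_arrow T (FOb L 0) (FOb L m)) (initial_arrow T (FOb L 0) (FOb L n))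
        (FMor L (ii0 m n)) (FMor L (ii1 m n)))"


section \<open>Universes\<close>

text \<open>
  HOL has no global membership relation on a type of sets. A universe is therefore a set \<open>U\<close> over
  an arbitrary type, together with its membership relation: \<open>elts x\<close> is the set of elements of
  \<open>x \<in> U\<close>. Only the values of \<open>elts\<close> on \<open>U\<close> matter. The clauses are extensionality (the elements of
  \<open>U\<close> are sets), transitivity, and closure under unordered pairs, power sets, and unions of
  families in \<open>U\<close> indexed by an element of \<open>U\<close>.
\<close>

definition grothendieck_universe :: "('v \<Rightarrow> 'v set) \<Rightarrow> 'v set \<Rightarrow> bool" where
  "grothendieck_universe elts U \<longleftrightarrow>
     inj_on elts U \<and>
     (\<forall>x\<in>U. elts x \<subseteq> U) \<and>
     (\<forall>x\<in>U. \<forall>y\<in>U. \<exists>z\<in>U. elts z = {x, y}) \<and>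
     (\<forall>x\<in>U. \<exists>p\<in>U. elts ` elts p = Pow (elts x)) \<and>
     (\<forall>x\<in>U. \<forall>a \<in> elts x \<rightarrow> U. \<exists>u\<in>U. elts u = (\<Union>i\<in>elts x. elts (a i)))"

text \<open>The set \<open>A\<close> is an element of \<open>U\<close>.\<close>

definition in_universe :: "('v \<Rightarrow> 'v set) \<Rightarrow> 'v set \<Rightarrow> 'v set \<Rightarrow> bool" where
  "in_universe elts U A \<longleftrightarrow> (\<exists>x\<in>U. elts x = A)"

text \<open>The element of \<open>U\<close> which the set \<open>A\<close> is, if \<open>in_universe elts U A\<close>.\<close>

definition as_element :: "('v \<Rightarrow> 'v set) \<Rightarrow> 'v set \<Rightarrow> 'v set \<Rightarrow> 'v" where
  "as_element elts U A = (THE x. x \<in> U \<and> elts x = A)"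

definition Sets :: "('v \<Rightarrow> 'v set) \<Rightarrow> 'v set \<Rightarrow> ('v, 'v \<times> 'v \<times> ('v \<Rightarrow> 'v)) cat" where
  "Sets elts U = fun_cat U elts"

text \<open>
  The set of natural numbers inside the universe is an injective image of the type \<^typ>\<open>nat\<close> under
  \<open>\<nu>\<close>, for instance \<open>\<nu> n\<close> the \<open>n\<close>-th von Neumann numeral. The functor takes \<open>n\<close> to \<open>stn n\<close> and
  each function to itself, read through this identification.
\<close>

definition Jf ::
  "('v \<Rightarrow> 'v set) \<Rightarrow> 'v set \<Rightarrow> (nat \<Rightarrow> 'v) \<Rightarrow> (nat, fmor, 'v, 'v \<times> 'v \<times> ('v \<Rightarrow> 'v)) fnct" where
  "Jf elts U \<nu> =
     (let st = (\<lambda>n. as_element elts U (\<nu> ` stn n)) in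
      \<lparr>FOb = st,
       FMor = (\<lambda>(m, n, f)\<in>Mor FF. (st m, st n, \<lambda>x\<in>\<nu> ` stn m. \<nu> (f (inv \<nu> x))))\<rparr>)"

definition LW ::
  "('v \<Rightarrow> 'v set) \<Rightarrow> 'v set
     \<Rightarrow> (('v, 'v) cat \<times> (nat, fmor, 'v, 'v) fnct,
         (('v, 'v) cat \<times> (nat, fmor, 'v, 'v) fnct) \<times>
         (('v, 'v) cat \<times> (nat, fmor, 'v, 'v) fnct) \<times> ('v, 'v, 'v, 'v) fnct) cat" where
  "LW elts U =
     hom_cat
       {(T, L). lawvere_theory T L \<and> in_universe elts U (Ob T) \<and> in_universe elts U (Mor T)}
       (\<lambda>(T, L) (T', L'). {G. is_functor T T' G \<and> functor_comp FF L G = L'})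
       (\<lambda>(T, L). functor_id T)
       (\<lambda>(T, L) G H. functor_comp T G H)"

end

theory Submission
  imports Defs
begin

text \<open>
  \<open>R\<close> sends a relative monad to its Kleisli category, transported along an injection of its
  morphisms into the universe, and a morphism of monads to postcomposition with its components.
  An element of \<open>RR n\<close> is a Kleisli morphism \<open>1 \<rightarrow> n\<close>, and a Kleisli morphism \<open>m \<rightarrow> n\<close> is
  determined by its restrictions to the \<open>m\<close> points \<open>1 \<rightarrow> m\<close>; hence \<open>R\<close> is fully faithful. It is
  essentially surjective: for a Lawvere theory \<open>(T, L)\<close> the sets \<open>Hom(L 1, L n)\<close> form a relative
  monad whose Kleisli category is isomorphic to \<open>T\<close>, since \<open>L m\<close> is the \<open>m\<close>-th copower of
  \<open>L 1\<close>. The functor \<open>S\<close> and the two natural isomorphisms then exist by choice.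
\<close>

section \<open>Categories and functors\<close>

text \<open>The obstacle is typing and size. Kleisli morphisms are tuples of numbers and functions,
  while \<open>LW\<close> consists of categories whose objects and morphisms are elements of
  \<open>U\<close>. Each Kleisli category is therefore replaced by a chosen small copy, and a
  functor between Kleisli categories is conjugated by the chosen isomorphisms. Conjugation is
  bijective and respects identities and composites, so no coherence between the choices is required.
  Morphisms of theories commute strictly with the functors from \<open>FF\<close>, hence essential
  surjectivity needs isomorphisms of categories that match these functors exactly; they exist
  because the Kleisli objects are the numbers themselves and \<open>L\<close> is bijective on
  objects. The push-out squares enter in two directions: for Kleisli categories they hold because a
  function on a disjoint union is a pair of functions, and for an arbitrary theory they are used, by
  induction on \<open>m\<close>, to construct morphisms out of \<open>L m\<close>.\<close>

lemma Hom_iff: "f \<in> Hom C X Y \<longleftrightarrow> f \<in> Mor C \<and> Src C f = X \<and> Tgt C f = Y"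
  by (simp add: Hom_def)

lemma categoryD:
  assumes "is_category C"
  shows "Src C \<in> Mor C \<rightarrow> Ob C" "Tgt C \<in> Mor C \<rightarrow> Ob C"
    "X \<in> Ob C \<Longrightarrow> Ident C X \<in> Hom C X X"
    "f \<in> Mor C \<Longrightarrow> g \<in> Mor C \<Longrightarrow> Tgt C f = Src C g \<Longrightarrow> Comp C f g \<in> Hom C (Src C f) (Tgt C g)"
    "f \<in> Mor C \<Longrightarrow> Comp C (Ident C (Src C f)) f = f"
    "f \<in> Mor C \<Longrightarrow> Comp C f (Ident C (Tgt C f)) = f"
    "f \<in> Mor C \<Longrightarrow> g \<in> Mor C \<Longrightarrow> h \<in> Mor C \<Longrightarrow> Tgt C f = Src C g \<Longrightarrow> Tgt C g = Src C h
      \<Longrightarrow> Comp C (Comp C f g) h = Comp C f (Comp C g h)"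
proof -
  note a = assms[unfolded is_category_def]
  show "Src C \<in> Mor C \<rightarrow> Ob C" "Tgt C \<in> Mor C \<rightarrow> Ob C"
    using conjunct1[OF a] conjunct1[OF conjunct2[OF a]] by (auto simp: PiE_def)
  note b = a[THEN conjunct2, THEN conjunct2, THEN conjunct2]
  show "X \<in> Ob C \<Longrightarrow> Ident C X \<in> Hom C X X"
    using b[THEN conjunct1] by blast
  show "f \<in> Mor C \<Longrightarrow> g \<in> Mor C \<Longrightarrow> Tgt C f = Src C g \<Longrightarrow> Comp C f g \<in> Hom C (Src C f) (Tgt C g)"
    using b[THEN conjunct2, THEN conjunct1] by blast
  note c = b[THEN conjunct2, THEN conjunct2, THEN conjunct2]
  show "f \<in> Mor C \<Longrightarrow> Comp C (Ident C (Src C f)) f = f"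
    "f \<in> Mor C \<Longrightarrow> Comp C f (Ident C (Tgt C f)) = f"
    using c[THEN conjunct1] by blast+
  show "f \<in> Mor C \<Longrightarrow> g \<in> Mor C \<Longrightarrow> h \<in> Mor C \<Longrightarrow> Tgt C f = Src C g \<Longrightarrow> Tgt C g = Src C h
      \<Longrightarrow> Comp C (Comp C f g) h = Comp C f (Comp C g h)"
    using c[THEN conjunct2] by simp
qed

lemma Src_Ob [simp]: "is_category C \<Longrightarrow> f \<in> Mor C \<Longrightarrow> Src C f \<in> Ob C"
  and Tgt_Ob [simp]: "is_category C \<Longrightarrow> f \<in> Mor C \<Longrightarrow> Tgt C f \<in> Ob C"
  using categoryD(1,2)[of C] by (auto simp: Pi_iff)

lemma Hom_Ob: "is_category C \<Longrightarrow> f \<in> Hom C X Y \<Longrightarrow> X \<in> Ob C \<and> Y \<in> Ob C"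
  by (auto simp: Hom_iff)

lemma Ident_simps [simp]:
  assumes "is_category C" "X \<in> Ob C"
  shows "Ident C X \<in> Mor C" "Src C (Ident C X) = X" "Tgt C (Ident C X) = X"
  using categoryD(3)[OF assms] by (simp_all add: Hom_iff)

lemma Ident_Hom: "is_category C \<Longrightarrow> X \<in> Ob C \<Longrightarrow> Ident C X \<in> Hom C X X"
  by (simp add: Hom_iff)

lemma Comp_simps [simp]:
  assumes "is_category C" "f \<in> Mor C" "g \<in> Mor C" "Tgt C f = Src C g"
  shows "Comp C f g \<in> Mor C" "Src C (Comp C f g) = Src C f" "Tgt C (Comp C f g) = Tgt C g"
  using categoryD(4)[OF assms] by (simp_all add: Hom_iff)

lemma Comp_Hom:
  "is_category C \<Longrightarrow> f \<in> Hom C X Y \<Longrightarrow> g \<in> Hom C Y Z \<Longrightarrow> Comp C f g \<in> Hom C X Z"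
  by (simp add: Hom_iff)

lemma Comp_Ident [simp]:
  assumes "is_category C" "f \<in> Mor C"
  shows "X = Src C f \<Longrightarrow> Comp C (Ident C X) f = f" "Y = Tgt C f \<Longrightarrow> Comp C f (Ident C Y) = f"
  using categoryD(5,6)[OF assms] by simp_all

lemma Comp_assoc [simp]:
  assumes "is_category C" "f \<in> Mor C" "g \<in> Mor C" "h \<in> Mor C" "Tgt C f = Src C g" "Tgt C g = Src C h"
  shows "Comp C (Comp C f g) h = Comp C f (Comp C g h)"
  using categoryD(7)[OF assms] .

lemma functor_cat:
  assumes "is_functor C D \<Phi>"
  shows "is_category C" "is_category D"
  using assms by (auto simp: is_functor_def)

lemma functor_Ob: "is_functor C D \<Phi> \<Longrightarrow> X \<in> Ob C \<Longrightarrow> FOb \<Phi> X \<in> Ob D"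
  by (auto simp: is_functor_def)

lemma functor_Hom:
  "is_functor C D \<Phi> \<Longrightarrow> f \<in> Hom C X Y \<Longrightarrow> FMor \<Phi> f \<in> Hom D (FOb \<Phi> X) (FOb \<Phi> Y)"
  by (auto simp: is_functor_def Hom_iff)

lemma functor_Mor:
  assumes "is_functor C D \<Phi>" "f \<in> Mor C"
  shows "FMor \<Phi> f \<in> Mor D" "Src D (FMor \<Phi> f) = FOb \<Phi> (Src C f)"
    "Tgt D (FMor \<Phi> f) = FOb \<Phi> (Tgt C f)"
  using assms by (auto simp: is_functor_def Hom_iff)

lemma functor_Ident: "is_functor C D \<Phi> \<Longrightarrow> X \<in> Ob C \<Longrightarrow> FMor \<Phi> (Ident C X) = Ident D (FOb \<Phi> X)"
  by (auto simp: is_functor_def)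

lemma functor_Comp:
  "is_functor C D \<Phi> \<Longrightarrow> f \<in> Mor C \<Longrightarrow> g \<in> Mor C \<Longrightarrow> Tgt C f = Src C g
    \<Longrightarrow> FMor \<Phi> (Comp C f g) = Comp D (FMor \<Phi> f) (FMor \<Phi> g)"
  by (auto simp: is_functor_def)

lemma functor_Comp_Hom:
  "is_functor C D \<Phi> \<Longrightarrow> f \<in> Hom C X Y \<Longrightarrow> g \<in> Hom C Y Z
    \<Longrightarrow> FMor \<Phi> (Comp C f g) = Comp D (FMor \<Phi> f) (FMor \<Phi> g)"
  by (auto simp: is_functor_def Hom_iff)

text \<open>Both functors are extensional, so their values outside \<open>C\<close> agree and
  pointwise agreement on \<open>C\<close> yields HOL equality. The strict equations over
  \<open>FF\<close> rest on this.\<close>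

lemma functor_eqI:
  assumes "is_functor C D \<Phi>" "is_functor C D \<Psi>"
    and "\<And>X. X \<in> Ob C \<Longrightarrow> FOb \<Phi> X = FOb \<Psi> X" "\<And>f. f \<in> Mor C \<Longrightarrow> FMor \<Phi> f = FMor \<Psi> f"
  shows "\<Phi> = \<Psi>"
proof (rule fnct.equality)
  show "FOb \<Phi> = FOb \<Psi>" by (rule extensionalityI[of _ "Ob C"]) (use assms in \<open>auto simp: is_functor_def PiE_def\<close>)
  show "FMor \<Phi> = FMor \<Psi>" by (rule extensionalityI[of _ "Mor C"]) (use assms in \<open>auto simp: is_functor_def PiE_def\<close>)
qed simp

lemma functor_id_functor: "is_category C \<Longrightarrow> is_functor C C (functor_id C)"
  by (auto simp: is_functor_def functor_id_def Hom_iff)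

lemma functor_comp_functor:
  assumes "is_functor C D \<Phi>" "is_functor D E \<Psi>"
  shows "is_functor C E (functor_comp C \<Phi> \<Psi>)"
  using functor_cat[OF assms(1)] functor_cat[OF assms(2)]
  by (auto simp: is_functor_def functor_comp_def Hom_iff functor_Mor[OF assms(1)] functor_Mor[OF assms(2)]
     functor_Ob[OF assms(1)] functor_Ob[OF assms(2)] functor_Ident[OF assms(1)] functor_Ident[OF assms(2)]
      functor_Comp[OF assms(1)] functor_Comp[OF assms(2)])

lemma functor_comp_sel [simp]:
  "X \<in> Ob C \<Longrightarrow> FOb (functor_comp C \<Phi> \<Psi>) X = FOb \<Psi> (FOb \<Phi> X)"
  "f \<in> Mor C \<Longrightarrow> FMor (functor_comp C \<Phi> \<Psi>) f = FMor \<Psi> (FMor \<Phi> f)"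
  by (auto simp: functor_comp_def)

lemma functor_id_sel [simp]:
  "X \<in> Ob C \<Longrightarrow> FOb (functor_id C) X = X" "f \<in> Mor C \<Longrightarrow> FMor (functor_id C) f = f"
  by (auto simp: functor_id_def)

lemma functor_comp_assoc:
  "is_functor C D \<Phi> \<Longrightarrow>
    functor_comp C (functor_comp C \<Phi> \<Psi>) \<Omega> = functor_comp C \<Phi> (functor_comp D \<Psi> \<Omega>)"
  by (auto simp: functor_comp_def functor_Ob functor_Mor restrict_def fun_eq_iff)

lemma functor_comp_id_left: "is_functor C D \<Phi> \<Longrightarrow> functor_comp C (functor_id C) \<Phi> = \<Phi>"
  by (rule functor_eqI[OF functor_comp_functor, OF functor_id_functor])
    (auto dest: functor_cat)

lemma functor_comp_id_right: "is_functor C D \<Phi> \<Longrightarrow> functor_comp C \<Phi> (functor_id D) = \<Phi>"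
  by (rule functor_eqI[OF functor_comp_functor, OF _ functor_id_functor])
    (auto dest: functor_cat simp: functor_Ob functor_Mor)

text \<open>Naturality of the inverse family need not be supplied: composing the square for
  \<open>\<alpha>\<close> with \<open>\<beta>\<close> on both sides gives the square for
  \<open>\<beta>\<close>.\<close>

lemma functor_isoI:
  assumes F: "is_functor C D \<Phi>" and G: "is_functor C D \<Psi>"
    and a: "\<And>X. X \<in> Ob C \<Longrightarrow> \<alpha> X \<in> Hom D (FOb \<Phi> X) (FOb \<Psi> X)"
    and b: "\<And>X. X \<in> Ob C \<Longrightarrow> \<beta> X \<in> Hom D (FOb \<Psi> X) (FOb \<Phi> X)"
    and ab: "\<And>X. X \<in> Ob C \<Longrightarrow> Comp D (\<alpha> X) (\<beta> X) = Ident D (FOb \<Phi> X)"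
    and ba: "\<And>X. X \<in> Ob C \<Longrightarrow> Comp D (\<beta> X) (\<alpha> X) = Ident D (FOb \<Psi> X)"
    and nat: "\<And>f. f \<in> Mor C \<Longrightarrow>
      Comp D (FMor \<Phi> f) (\<alpha> (Tgt C f)) = Comp D (\<alpha> (Src C f)) (FMor \<Psi> f)"
  shows "functor_iso C D \<Phi> \<Psi> (restrict \<alpha> (Ob C))"
proof -
  note [simp] = functor_cat[OF F] functor_cat[OF G] functor_Mor[OF F] functor_Mor[OF G]
    functor_Ob[OF F] functor_Ob[OF G]
  note [simp] = a[unfolded Hom_iff] b[unfolded Hom_iff]
  have natb: "Comp D (FMor \<Psi> f) (\<beta> (Tgt C f)) = Comp D (\<beta> (Src C f)) (FMor \<Phi> f)"
    if f: "f \<in> Mor C" for f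
  proof -
    have "Comp D (FMor \<Psi> f) (\<beta> (Tgt C f))
      = Comp D (Comp D (\<beta> (Src C f)) (\<alpha> (Src C f))) (Comp D (FMor \<Psi> f) (\<beta> (Tgt C f)))"
      by (subst ba) (use f in auto)
    also have "\<dots> = Comp D (\<beta> (Src C f)) (Comp D (Comp D (\<alpha> (Src C f)) (FMor \<Psi> f)) (\<beta> (Tgt C f)))"
      using f by simp
    also have "\<dots> = Comp D (\<beta> (Src C f)) (Comp D (FMor \<Phi> f) (Comp D (\<alpha> (Tgt C f)) (\<beta> (Tgt C f))))"
      unfolding nat[OF f, symmetric] using f by simp
    also have "\<dots> = Comp D (\<beta> (Src C f)) (FMor \<Phi> f)"
      using f by (simp add: ab)
    finally show ?thesis .
  qed
  show ?thesis
    unfolding functor_iso_def nat_trans_def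
    using F G a b by (intro conjI exI[of _ "restrict \<beta> (Ob C)"]) (simp_all add: ab ba nat natb)
qed


text \<open>The quasi-inverse is chosen objectwise; it is a functor by faithfulness.\<close>

lemma equivalence_if_fully_faithful_essentially_surjective:
  assumes R: "is_functor C D R"
    and full: "\<And>X Y g. X \<in> Ob C \<Longrightarrow> Y \<in> Ob C \<Longrightarrow> g \<in> Hom D (FOb R X) (FOb R Y)
      \<Longrightarrow> \<exists>f \<in> Hom C X Y. FMor R f = g"
    and faithful: "\<And>X Y f g. f \<in> Hom C X Y \<Longrightarrow> g \<in> Hom C X Y \<Longrightarrow> FMor R f = FMor R g \<Longrightarrow> f = g"
    and surj: "\<And>Y. Y \<in> Ob D \<Longrightarrow> \<exists>X \<in> Ob C. \<exists>p \<in> Hom D (FOb R X) Y. \<exists>q \<in> Hom D Y (FOb R X).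
      Comp D p q = Ident D (FOb R X) \<and> Comp D q p = Ident D Y"
  shows "\<exists>S \<alpha> \<beta>. is_functor D C S \<and>
    functor_iso C C (functor_comp C R S) (functor_id C) \<alpha> \<and>
    functor_iso D D (functor_comp D S R) (functor_id D) \<beta>"
proof -
  note [simp] = functor_cat[OF R] functor_Mor[OF R] functor_Ob[OF R] functor_Comp[OF R] functor_Ident[OF R]
  obtain s p q where spq: "\<And>Y. Y \<in> Ob D \<Longrightarrow> s Y \<in> Ob C \<and> p Y \<in> Hom D (FOb R (s Y)) Y \<and>
      q Y \<in> Hom D Y (FOb R (s Y)) \<and> Comp D (p Y) (q Y) = Ident D (FOb R (s Y)) \<and>
      Comp D (q Y) (p Y) = Ident D Y"
    using surj by metis
  have s [simp]: "s Y \<in> Ob C"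
    and p [simp]: "p Y \<in> Mor D" "Src D (p Y) = FOb R (s Y)" "Tgt D (p Y) = Y"
    and q [simp]: "q Y \<in> Mor D" "Src D (q Y) = Y" "Tgt D (q Y) = FOb R (s Y)"
    and pq [simp]: "Comp D (p Y) (q Y) = Ident D (FOb R (s Y))"
    and qp [simp]: "Comp D (q Y) (p Y) = Ident D Y" if "Y \<in> Ob D" for Y
    using spq[OF that] by (auto simp: Hom_iff)
  have qp': "Comp D (q Y) (Comp D (p Y) g) = g" if "Y \<in> Ob D" "g \<in> Mor D" "Src D g = Y" for Y g
    using Comp_assoc[of D "q Y" "p Y" g] that by simp
  \<comment> \<open>A chosen lift of \<open>g : R X \<rightarrow> R Y\<close> along
    \<open>R\<close>, available by fullness.\<close>
  define l where "l X Y g = (SOME f. f \<in> Hom C X Y \<and> FMor R f = g)" for X Y g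
  have l: "l X Y g \<in> Hom C X Y \<and> FMor R (l X Y g) = g"
    if "X \<in> Ob C" "Y \<in> Ob C" "g \<in> Mor D" "Src D g = FOb R X" "Tgt D g = FOb R Y" for X Y g
    unfolding l_def by (rule someI_ex) (use full[of X Y g] that in \<open>auto simp: Hom_iff\<close>)
  have l1 [simp]: "l X Y g \<in> Mor C" "Src C (l X Y g) = X" "Tgt C (l X Y g) = Y" "FMor R (l X Y g) = g"
    if "X \<in> Ob C" "Y \<in> Ob C" "g \<in> Mor D" "Src D g = FOb R X" "Tgt D g = FOb R Y" for X Y g
    using l[OF that] by (auto simp: Hom_iff)
  \<comment> \<open>By faithfulness, each equation in \<open>C\<close> below may be checked after
    applying \<open>R\<close>, where the lifts \<open>l\<close> disappear.\<close>
  have eq: "f = g" if "f \<in> Mor C" "g \<in> Mor C" "Src C f = Src C g" "Tgt C f = Tgt C g" "FMor R f = FMor R g"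
    for f g
    using faithful[of f "Src C g" "Tgt C g" g] that by (simp add: Hom_iff)
  \<comment> \<open>\<open>S g\<close> lifts \<open>g\<close> conjugated by the isomorphisms
    \<open>p\<close> and \<open>q\<close>. In a composite the inner factors \<open>q\<close> and
    \<open>p\<close> cancel, which is what \<open>qp'\<close> is for.\<close>
  define S where "S = \<lparr>FOb = restrict s (Ob D), FMor = (\<lambda>g\<in>Mor D. l (s (Src D g)) (s (Tgt D g))
      (Comp D (p (Src D g)) (Comp D g (q (Tgt D g)))))\<rparr>"
  have S [simp]: "Y \<in> Ob D \<Longrightarrow> FOb S Y = s Y"
    "g \<in> Mor D \<Longrightarrow> FMor S g = l (s (Src D g)) (s (Tgt D g)) (Comp D (p (Src D g)) (Comp D g (q (Tgt D g))))"
    for Y g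
    by (simp_all add: S_def)
  have SF: "is_functor D C S"
    unfolding is_functor_def
  proof (intro conjI ballI impI)
    show "FOb S \<in> Ob D \<rightarrow>\<^sub>E Ob C" "FMor S \<in> extensional (Mor D)" by (auto simp: S_def)
    show "FMor S (Ident D X) = Ident C (FOb S X)" if "X \<in> Ob D" for X
      by (rule eq) (use that in auto)
    show "FMor S (Comp D f g) = Comp C (FMor S f) (FMor S g)"
      if "f \<in> Mor D" "g \<in> Mor D" "Tgt D f = Src D g" for f g
      by (rule eq) (use that in \<open>auto simp: qp'\<close>)
  qed (auto simp: Hom_iff)
  \<comment> \<open>The isomorphism \<open>p (R X)\<close> runs from \<open>R (s (R X))\<close> to
    \<open>R X\<close>, both images of objects of \<open>C\<close>, so it and its inverse lift to
    \<open>C\<close>.\<close>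
  let ?\<alpha> = "\<lambda>X. l (s (FOb R X)) X (p (FOb R X))" and ?\<beta> = "\<lambda>X. l X (s (FOb R X)) (q (FOb R X))"
  have 1: "functor_iso C C (functor_comp C R S) (functor_id C) (restrict ?\<alpha> (Ob C))"
  proof (rule functor_isoI[OF functor_comp_functor[OF R SF] functor_id_functor])
    fix X assume X: "X \<in> Ob C"
    show "Comp C (?\<alpha> X) (?\<beta> X) = Ident C (FOb (functor_comp C R S) X)"
      by (rule eq) (use X in auto)
    show "Comp C (?\<beta> X) (?\<alpha> X) = Ident C (FOb (functor_id C) X)"
      by (rule eq) (use X in auto)
  next
    fix f assume f: "f \<in> Mor C"
    show "Comp C (FMor (functor_comp C R S) f) (?\<alpha> (Tgt C f)) = Comp C (?\<alpha> (Src C f)) (FMor (functor_id C) f)"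
      by (rule eq) (use f in \<open>auto simp: qp'\<close>)
  qed (auto simp: Hom_iff)
  \<comment> \<open>Here \<open>p\<close> itself is natural: \<open>R (S g)\<close> is
    \<open>p\<close>, \<open>g\<close>, \<open>q\<close> in this order, and a further
    \<open>p\<close> cancels the \<open>q\<close>.\<close>
  have 2: "functor_iso D D (functor_comp D S R) (functor_id D) (restrict p (Ob D))"
    by (rule functor_isoI[OF functor_comp_functor[OF SF R] functor_id_functor, where \<beta> = q])
      (auto simp: Hom_iff)
  show ?thesis using SF 1 2 by blast
qed


section \<open>Categories given by families of hom-sets\<close>

text \<open>Unlike in \<^const>\<open>hom_cat\<close>, the composite may depend on all three objects, as it does for the
  Kleisli category of a relative monad.\<close>

definition homset_cat ::
  "'o set \<Rightarrow> ('o \<Rightarrow> 'o \<Rightarrow> 'a set) \<Rightarrow> ('o \<Rightarrow> 'a) \<Rightarrow> ('o \<Rightarrow> 'o \<Rightarrow> 'o \<Rightarrow> 'a \<Rightarrow> 'a \<Rightarrow> 'a)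
     \<Rightarrow> ('o, 'o \<times> 'o \<times> 'a) cat" where
  "homset_cat B H i c =
     (let M = {(X, Y, f). X \<in> B \<and> Y \<in> B \<and> f \<in> H X Y} in
      \<lparr>Ob = B,
       Mor = M,
       Src = (\<lambda>a\<in>M. fst a),
       Tgt = (\<lambda>a\<in>M. fst (snd a)),
       Ident = (\<lambda>X\<in>B. (X, X, i X)),
       Comp = (\<lambda>a b. if a \<in> M \<and> b \<in> M \<and> fst (snd a) = fst b
                     then (fst a, fst (snd b),
                       c (fst a) (fst b) (fst (snd b)) (snd (snd a)) (snd (snd b)))
                     else undefined)\<rparr>)"

lemma hom_cat_homset_cat: "hom_cat B H i c = homset_cat B H i (\<lambda>X Y Z. c X)"
  by (simp add: hom_cat_def homset_cat_def)

lemma homset_cat_simps [simp]: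
  "Ob (homset_cat B H i c) = B"
  "Mor (homset_cat B H i c) = {(X, Y, f). X \<in> B \<and> Y \<in> B \<and> f \<in> H X Y}"
  "X \<in> B \<Longrightarrow> Ident (homset_cat B H i c) X = (X, X, i X)"
  by (auto simp: homset_cat_def Let_def)

lemma homset_cat_Src_Tgt [simp]:
  assumes "X \<in> B" "Y \<in> B" "f \<in> H X Y"
  shows "Src (homset_cat B H i c) (X, Y, f) = X" "Tgt (homset_cat B H i c) (X, Y, f) = Y"
  using assms by (auto simp: homset_cat_def Let_def)

lemma homset_cat_Comp [simp]:
  assumes "X \<in> B" "Y \<in> B" "Z \<in> B" "f \<in> H X Y" "g \<in> H Y Z"
  shows "Comp (homset_cat B H i c) (X, Y, f) (Y, Z, g) = (X, Z, c X Y Z f g)"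
  using assms by (auto simp: homset_cat_def Let_def)

lemma Hom_homset_cat:
  "a \<in> Hom (homset_cat B H i c) X Y \<longleftrightarrow> X \<in> B \<and> Y \<in> B \<and> (\<exists>f\<in>H X Y. a = (X, Y, f))"
  by (auto simp: Hom_iff)

lemma homset_cat_category:
  assumes i: "\<And>X. X \<in> B \<Longrightarrow> i X \<in> H X X"
    and c: "\<And>X Y Z f g. X \<in> B \<Longrightarrow> Y \<in> B \<Longrightarrow> Z \<in> B \<Longrightarrow> f \<in> H X Y \<Longrightarrow> g \<in> H Y Z \<Longrightarrow> c X Y Z f g \<in> H X Z"
    and l: "\<And>X Y f. X \<in> B \<Longrightarrow> Y \<in> B \<Longrightarrow> f \<in> H X Y \<Longrightarrow> c X X Y (i X) f = f"
    and r: "\<And>X Y f. X \<in> B \<Longrightarrow> Y \<in> B \<Longrightarrow> f \<in> H X Y \<Longrightarrow> c X Y Y f (i Y) = f"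
    and a: "\<And>W X Y Z f g h. W \<in> B \<Longrightarrow> X \<in> B \<Longrightarrow> Y \<in> B \<Longrightarrow> Z \<in> B \<Longrightarrow>
      f \<in> H W X \<Longrightarrow> g \<in> H X Y \<Longrightarrow> h \<in> H Y Z \<Longrightarrow> c W Y Z (c W X Y f g) h = c W X Z f (c X Y Z g h)"
  shows "is_category (homset_cat B H i c)"
  unfolding is_category_def
proof (intro conjI ballI allI impI)
  let ?C = "homset_cat B H i c"
  show "Src ?C \<in> Mor ?C \<rightarrow>\<^sub>E Ob ?C" "Tgt ?C \<in> Mor ?C \<rightarrow>\<^sub>E Ob ?C" "Ident ?C \<in> extensional (Ob ?C)"
    by (auto simp: homset_cat_def Let_def)
  show "Comp ?C f g = undefined" if "\<not> (f \<in> Mor ?C \<and> g \<in> Mor ?C \<and> Tgt ?C f = Src ?C g)" for f g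
    using that by (auto simp: homset_cat_def Let_def)
  show "Comp ?C f g \<in> Hom ?C (Src ?C f) (Tgt ?C g)"
    if "f \<in> Mor ?C \<and> g \<in> Mor ?C \<and> Tgt ?C f = Src ?C g" for f g
    using that c by (auto simp: Hom_homset_cat)
  show "Comp ?C (Comp ?C f g) h = Comp ?C f (Comp ?C g h)"
    if "f \<in> Mor ?C" "g \<in> Mor ?C" "h \<in> Mor ?C" "Tgt ?C f = Src ?C g \<and> Tgt ?C g = Src ?C h" for f g h
    using that by (auto simp: c a)
qed (auto simp: Hom_homset_cat i l r)

lemma fun_cat_category: "is_category (fun_cat B S)"
  unfolding fun_cat_def hom_cat_homset_cat
proof (rule homset_cat_category)
  fix W X Y Z f g h
  assume "f \<in> S W \<rightarrow>\<^sub>E S X" "g \<in> S X \<rightarrow>\<^sub>E S Y" "h \<in> S Y \<rightarrow>\<^sub>E S Z"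
  then show "compose (S W) h (compose (S W) g f) = compose (S W) (compose (S X) h g) f"
    by (auto simp: compose_def fun_eq_iff)
qed (auto simp: compose_def fun_eq_iff PiE_def extensional_def)

lemma fun_cat_simps [simp]:
  "Ob (fun_cat B S) = B"
  "Mor (fun_cat B S) = {(X, Y, f). X \<in> B \<and> Y \<in> B \<and> f \<in> S X \<rightarrow>\<^sub>E S Y}"
  "X \<in> B \<Longrightarrow> Ident (fun_cat B S) X = (X, X, \<lambda>x\<in>S X. x)"
  "X \<in> B \<Longrightarrow> Y \<in> B \<Longrightarrow> f \<in> S X \<rightarrow>\<^sub>E S Y \<Longrightarrow> Src (fun_cat B S) (X, Y, f) = X"
  "X \<in> B \<Longrightarrow> Y \<in> B \<Longrightarrow> f \<in> S X \<rightarrow>\<^sub>E S Y \<Longrightarrow> Tgt (fun_cat B S) (X, Y, f) = Y"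
  "X \<in> B \<Longrightarrow> Y \<in> B \<Longrightarrow> Z \<in> B \<Longrightarrow> f \<in> S X \<rightarrow>\<^sub>E S Y \<Longrightarrow> g \<in> S Y \<rightarrow>\<^sub>E S Z
    \<Longrightarrow> Comp (fun_cat B S) (X, Y, f) (Y, Z, g) = (X, Z, \<lambda>x\<in>S X. g (f x))"
  by (simp_all add: fun_cat_def hom_cat_homset_cat compose_def)

lemma Hom_fun_cat:
  "a \<in> Hom (fun_cat B S) X Y \<longleftrightarrow> X \<in> B \<and> Y \<in> B \<and> (\<exists>f\<in>S X \<rightarrow>\<^sub>E S Y. a = (X, Y, f))"
  by (simp add: fun_cat_def hom_cat_homset_cat Hom_homset_cat)


section \<open>Relative monads and their Kleisli categories\<close>

lemma relative_monad_functor: "relative_monad C D J M \<Longrightarrow> is_functor C D J"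
  by (simp add: relative_monad_def)

lemma relative_monad_RR: "relative_monad C D J M \<Longrightarrow> X \<in> Ob C \<Longrightarrow> RR M X \<in> Ob D"
  by (auto simp: relative_monad_def)

lemma relative_monad_eta:
  assumes "relative_monad C D J M" "X \<in> Ob C"
  shows "eta M X \<in> Mor D" "Src D (eta M X) = FOb J X" "Tgt D (eta M X) = RR M X"
  using assms by (auto simp: relative_monad_def Hom_iff)

lemma relative_monad_rho:
  assumes "relative_monad C D J M" "X \<in> Ob C" "Y \<in> Ob C" "f \<in> Mor D" "Src D f = FOb J X" "Tgt D f = RR M Y"
  shows "rho M X Y f \<in> Mor D" "Src D (rho M X Y f) = RR M X" "Tgt D (rho M X Y f) = RR M Y"
    and "Comp D (eta M X) (rho M X Y f) = f"
  using assms by (auto simp: relative_monad_def Hom_iff)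

lemma relative_monad_rho_eta:
  "relative_monad C D J M \<Longrightarrow> X \<in> Ob C \<Longrightarrow> rho M X X (eta M X) = Ident D (RR M X)"
  by (auto simp: relative_monad_def)

lemma relative_monad_rho_rho:
  "relative_monad C D J M \<Longrightarrow> X \<in> Ob C \<Longrightarrow> Y \<in> Ob C \<Longrightarrow> Z \<in> Ob C \<Longrightarrow>
    f \<in> Mor D \<Longrightarrow> Src D f = FOb J X \<Longrightarrow> Tgt D f = RR M Y \<Longrightarrow>
    g \<in> Mor D \<Longrightarrow> Src D g = FOb J Y \<Longrightarrow> Tgt D g = RR M Z \<Longrightarrow>
    rho M X Z (Comp D f (rho M Y Z g)) = Comp D (rho M X Y f) (rho M Y Z g)"
  by (simp add: relative_monad_def Hom_def)

lemmas relative_monad_simps = relative_monad_RR relative_monad_eta relative_monad_rho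
  relative_monad_rho_eta relative_monad_rho_rho

lemma rmon_morphism_Mor:
  assumes "rmon_morphism C D J M M' \<phi>" "X \<in> Ob C"
  shows "\<phi> X \<in> Mor D" "Src D (\<phi> X) = RR M X" "Tgt D (\<phi> X) = RR M' X"
    and "Comp D (eta M X) (\<phi> X) = eta M' X"
  using assms by (auto simp: rmon_morphism_def Hom_iff)

lemma rmon_morphism_rho:
  assumes "rmon_morphism C D J M M' \<phi>"
    and "X \<in> Ob C" "Y \<in> Ob C" "f \<in> Mor D" "Src D f = FOb J X" "Tgt D f = RR M Y"
  shows "Comp D (rho M X Y f) (\<phi> Y) = Comp D (\<phi> X) (rho M' X Y (Comp D f (\<phi> Y)))"
  using assms by (auto simp: rmon_morphism_def Hom_iff)

lemma rmon_morphism_ext: "rmon_morphism C D J M M' \<phi> \<Longrightarrow> \<phi> \<in> extensional (Ob C)"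
  by (simp add: rmon_morphism_def)

lemma rmon_morphism_Ident:
  assumes M: "relative_monad C D J M"
  shows "rmon_morphism C D J M M (\<lambda>X\<in>Ob C. Ident D (RR M X))"
  using relative_monad_functor[OF M, THEN functor_cat(2)]
  by (auto simp: rmon_morphism_def Hom_iff relative_monad_simps[OF M])

text \<open>The two compatibility squares are pasted: the one for \<open>\<phi>\<close> passes from
  \<open>rho M\<close> at \<open>f\<close> to \<open>rho M'\<close> at \<open>f\<close> followed by
  \<open>\<phi> Y\<close>, and the one for \<open>\<psi>\<close> is applied to that
  composite.\<close>

lemma rmon_morphism_Comp:
  assumes M: "relative_monad C D J M" "relative_monad C D J M'" "relative_monad C D J M''"
    and p: "rmon_morphism C D J M M' \<phi>" and q: "rmon_morphism C D J M' M'' \<psi>"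
  shows "rmon_morphism C D J M M'' (\<lambda>X\<in>Ob C. Comp D (\<phi> X) (\<psi> X))"
  unfolding rmon_morphism_def
proof (intro conjI ballI)
  note [simp] = relative_monad_functor[OF M(1), THEN functor_cat(2)]
    relative_monad_simps[OF M(1)] relative_monad_simps[OF M(2)] relative_monad_simps[OF M(3)]
    rmon_morphism_Mor[OF p] rmon_morphism_Mor[OF q]
  show "(\<lambda>X\<in>Ob C. Comp D (\<phi> X) (\<psi> X)) X \<in> Hom D (RR M X) (RR M'' X)" if "X \<in> Ob C" for X
    using that by (simp add: Hom_iff)
  show "eta M'' X = Comp D (eta M X) ((\<lambda>X\<in>Ob C. Comp D (\<phi> X) (\<psi> X)) X)" if "X \<in> Ob C" for X
    using that Comp_assoc[of D "eta M X" "\<phi> X" "\<psi> X"] by simp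
  fix X Y f assume "X \<in> Ob C" "Y \<in> Ob C" "f \<in> Hom D (FOb J X) (RR M Y)"
  then have [simp]: "X \<in> Ob C" "Y \<in> Ob C" "f \<in> Mor D" "Src D f = FOb J X" "Tgt D f = RR M Y"
    by (auto simp: Hom_iff)
  have "Comp D (rho M X Y f) (Comp D (\<phi> Y) (\<psi> Y)) = Comp D (Comp D (rho M X Y f) (\<phi> Y)) (\<psi> Y)"
    by simp
  also have "\<dots> = Comp D (Comp D (\<phi> X) (rho M' X Y (Comp D f (\<phi> Y)))) (\<psi> Y)"
    by (subst rmon_morphism_rho[OF p]) simp_all
  also have "\<dots> = Comp D (\<phi> X) (Comp D (rho M' X Y (Comp D f (\<phi> Y))) (\<psi> Y))"
    by simp
  also have "\<dots> = Comp D (\<phi> X) (Comp D (\<psi> X) (rho M'' X Y (Comp D f (Comp D (\<phi> Y) (\<psi> Y)))))"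
    by (subst rmon_morphism_rho[OF q]) simp_all
  finally show "Comp D (rho M X Y f) ((\<lambda>X\<in>Ob C. Comp D (\<phi> X) (\<psi> X)) Y) =
    Comp D ((\<lambda>X\<in>Ob C. Comp D (\<phi> X) (\<psi> X)) X)
      (rho M'' X Y (Comp D f ((\<lambda>X\<in>Ob C. Comp D (\<phi> X) (\<psi> X)) Y)))"
    by simp
qed simp

lemma RMon_category: "is_category (RMon C D J)"
  unfolding RMon_def hom_cat_homset_cat
proof (rule homset_cat_category, goal_cases)
  case (3 M M' f)
  then show ?case
    using rmon_morphism_Mor[of C D J M M' f] relative_monad_functor[of C D J M, THEN functor_cat(2)]
    by (auto simp: fun_eq_iff dest: rmon_morphism_ext simp: extensional_def)
next
  case (4 M M' f)
  then show ?case
    using rmon_morphism_Mor[of C D J M M' f] relative_monad_functor[of C D J M, THEN functor_cat(2)]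
    by (auto simp: fun_eq_iff dest: rmon_morphism_ext simp: extensional_def)
next
  case (5 M M' M'' M''' f g h)
  then show ?case
    using rmon_morphism_Mor[of C D J M M' f] rmon_morphism_Mor[of C D J M' M'' g]
      rmon_morphism_Mor[of C D J M'' M''' h] relative_monad_functor[of C D J M, THEN functor_cat(2)]
    by (auto simp: fun_eq_iff)
qed (auto intro: rmon_morphism_Ident rmon_morphism_Comp)

section \<open>Kleisli categories and the functors between them\<close>

definition kleisli ::
  "('oc, 'mc) cat \<Rightarrow> ('od, 'md) cat \<Rightarrow> ('oc, 'mc, 'od, 'md) fnct
     \<Rightarrow> ('oc, 'od, 'md) rmon \<Rightarrow> ('oc, 'oc \<times> 'oc \<times> 'md) cat" where
  "kleisli C D J M = homset_cat (Ob C) (\<lambda>X Y. Hom D (FOb J X) (RR M Y)) (eta M)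
     (\<lambda>X Y Z f g. Comp D f (rho M Y Z g))"

lemma kleisli_simps [simp]:
  "Ob (kleisli C D J M) = Ob C"
  "Mor (kleisli C D J M) = {(X, Y, f). X \<in> Ob C \<and> Y \<in> Ob C \<and> f \<in> Hom D (FOb J X) (RR M Y)}"
  "X \<in> Ob C \<Longrightarrow> Ident (kleisli C D J M) X = (X, X, eta M X)"
  "X \<in> Ob C \<Longrightarrow> Y \<in> Ob C \<Longrightarrow> f \<in> Hom D (FOb J X) (RR M Y) \<Longrightarrow> Src (kleisli C D J M) (X, Y, f) = X"
  "X \<in> Ob C \<Longrightarrow> Y \<in> Ob C \<Longrightarrow> f \<in> Hom D (FOb J X) (RR M Y) \<Longrightarrow> Tgt (kleisli C D J M) (X, Y, f) = Y"
  "X \<in> Ob C \<Longrightarrow> Y \<in> Ob C \<Longrightarrow> Z \<in> Ob C \<Longrightarrow> f \<in> Hom D (FOb J X) (RR M Y) \<Longrightarrow> g \<in> Hom D (FOb J Y) (RR M Z)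
    \<Longrightarrow> Comp (kleisli C D J M) (X, Y, f) (Y, Z, g) = (X, Z, Comp D f (rho M Y Z g))"
  by (simp_all add: kleisli_def)

lemma Hom_kleisli:
  "a \<in> Hom (kleisli C D J M) X Y \<longleftrightarrow>
    X \<in> Ob C \<and> Y \<in> Ob C \<and> (\<exists>f \<in> Hom D (FOb J X) (RR M Y). a = (X, Y, f))"
  by (simp add: kleisli_def Hom_homset_cat)

text \<open>The three monad axioms are the three category axioms: \<open>rho\<close> of
  \<open>eta\<close> being the identity is the right unit law, \<open>eta\<close> followed by
  \<open>rho f\<close> being \<open>f\<close> is the left unit law, and the axiom on
  \<open>rho f\<close> followed by \<open>rho g\<close> is associativity.\<close>

lemma kleisli_category:
  assumes M: "relative_monad C D J M"
  shows "is_category (kleisli C D J M)"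
  unfolding kleisli_def using relative_monad_functor[OF M, THEN functor_cat(2)]
  by (intro homset_cat_category) (auto simp: Hom_iff relative_monad_simps[OF M])

definition kleisli_functor ::
  "('oc, 'mc) cat \<Rightarrow> ('od, 'md) cat \<Rightarrow> ('oc, 'mc, 'od, 'md) fnct
     \<Rightarrow> ('oc, 'od, 'md) rmon \<Rightarrow> ('oc, 'mc, 'oc, 'oc \<times> 'oc \<times> 'md) fnct" where
  "kleisli_functor C D J M = \<lparr>FOb = (\<lambda>X\<in>Ob C. X),
     FMor = (\<lambda>f\<in>Mor C. (Src C f, Tgt C f, Comp D (FMor J f) (eta M (Tgt C f))))\<rparr>"

lemma kleisli_functor_simps [simp]:
  "X \<in> Ob C \<Longrightarrow> FOb (kleisli_functor C D J M) X = X"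
  "f \<in> Mor C \<Longrightarrow> FMor (kleisli_functor C D J M) f
    = (Src C f, Tgt C f, Comp D (FMor J f) (eta M (Tgt C f)))"
  by (simp_all add: kleisli_functor_def)

text \<open>Composites are preserved because, inside a Kleisli composite, \<open>eta\<close>
  followed by \<open>rho\<close> of the second morphism is that morphism.\<close>

lemma kleisli_functor:
  assumes M: "relative_monad C D J M"
  shows "is_functor C (kleisli C D J M) (kleisli_functor C D J M)"
proof -
  note J = relative_monad_functor[OF M]
  note [simp] = functor_cat[OF J] functor_Mor[OF J] functor_Ob[OF J] functor_Comp[OF J] functor_Ident[OF J]
    relative_monad_simps[OF M] kleisli_category[OF M]
  show ?thesis
    unfolding is_functor_def
    by (auto simp: Hom_kleisli Hom_iff kleisli_functor_def)
qed

definition kleisli_map ::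
  "('oc, 'mc) cat \<Rightarrow> ('od, 'md) cat \<Rightarrow> ('oc, 'mc, 'od, 'md) fnct \<Rightarrow> ('oc, 'od, 'md) rmon
     \<Rightarrow> ('oc \<Rightarrow> 'md) \<Rightarrow> ('oc, 'oc \<times> 'oc \<times> 'md, 'oc, 'oc \<times> 'oc \<times> 'md) fnct" where
  "kleisli_map C D J M \<phi> = \<lparr>FOb = (\<lambda>X\<in>Ob C. X),
     FMor = (\<lambda>(X, Y, f)\<in>Mor (kleisli C D J M). (X, Y, Comp D f (\<phi> Y)))\<rparr>"

lemma kleisli_map_simps [simp]:
  "X \<in> Ob C \<Longrightarrow> FOb (kleisli_map C D J M \<phi>) X = X"
  "X \<in> Ob C \<Longrightarrow> Y \<in> Ob C \<Longrightarrow> f \<in> Hom D (FOb J X) (RR M Y)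
    \<Longrightarrow> FMor (kleisli_map C D J M \<phi>) (X, Y, f) = (X, Y, Comp D f (\<phi> Y))"
  by (simp_all add: kleisli_map_def)

context
  fixes C :: "('oc, 'mc) cat" and D :: "('od, 'md) cat" and J and M M' :: "('oc, 'od, 'md) rmon" and \<phi>
  assumes M: "relative_monad C D J M" and M': "relative_monad C D J M'"
    and \<phi>: "rmon_morphism C D J M M' \<phi>"
begin

text \<open>The condition on \<open>eta\<close> in a morphism of monads gives preservation of
  identities, the condition on \<open>rho\<close> preservation of composites.\<close>

lemma kleisli_map_functor: "is_functor (kleisli C D J M) (kleisli C D J M') (kleisli_map C D J M \<phi>)"
proof -
  note J = relative_monad_functor[OF M]
  note [simp] = functor_cat[OF J] functor_Mor[OF J] functor_Ob[OF J]
    relative_monad_simps[OF M] relative_monad_simps[OF M'] rmon_morphism_Mor[OF \<phi>]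
    kleisli_category[OF M] kleisli_category[OF M']
  show ?thesis
    unfolding is_functor_def
  proof (intro conjI ballI impI)
    let ?K = "kleisli C D J M" and ?K' = "kleisli C D J M'" and ?G = "kleisli_map C D J M \<phi>"
    show "FOb ?G \<in> Ob ?K \<rightarrow>\<^sub>E Ob ?K'" "FMor ?G \<in> extensional (Mor ?K)"
      unfolding kleisli_map_def fnct.simps by auto
    show "FMor ?G (Comp ?K f g) = Comp ?K' (FMor ?G f) (FMor ?G g)"
      if "f \<in> Mor ?K" "g \<in> Mor ?K" "Tgt ?K f = Src ?K g" for f g
      using that by (auto simp: Hom_iff rmon_morphism_rho[OF \<phi>])
  qed (auto simp: Hom_kleisli Hom_iff)
qed

text \<open>Since \<open>eta M\<close> followed by \<open>\<phi>\<close> is \<open>eta M'\<close>,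
  the functor sends \<open>J f\<close> followed by \<open>eta M\<close> to \<open>J f\<close>
  followed by \<open>eta M'\<close>. This makes it a morphism of Lawvere theories.\<close>

lemma kleisli_map_under:
  "functor_comp C (kleisli_functor C D J M) (kleisli_map C D J M \<phi>) = kleisli_functor C D J M'"
proof (rule functor_eqI[OF functor_comp_functor[OF kleisli_functor[OF M] kleisli_map_functor] kleisli_functor[OF M']])
  note J = relative_monad_functor[OF M]
  note [simp] = functor_cat[OF J] functor_Mor[OF J] functor_Ob[OF J]
    relative_monad_simps[OF M] relative_monad_simps[OF M'] rmon_morphism_Mor[OF \<phi>]
  show "FMor (functor_comp C (kleisli_functor C D J M) (kleisli_map C D J M \<phi>)) f
      = FMor (kleisli_functor C D J M') f" if "f \<in> Mor C" for f
    using that by (auto simp: Hom_iff)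
qed auto

end

lemma kleisli_map_Ident:
  assumes M: "relative_monad C D J M"
  shows "kleisli_map C D J M (\<lambda>X\<in>Ob C. Ident D (RR M X)) = functor_id (kleisli C D J M)"
  using relative_monad_functor[OF M, THEN functor_cat(2)]
  by (auto simp: kleisli_map_def functor_id_def fun_eq_iff Hom_iff)

lemma kleisli_map_Comp:
  assumes M: "relative_monad C D J M"
    and p: "rmon_morphism C D J M M' \<phi>" and q: "rmon_morphism C D J M' M'' \<psi>"
  shows "kleisli_map C D J M (\<lambda>X\<in>Ob C. Comp D (\<phi> X) (\<psi> X))
    = functor_comp (kleisli C D J M) (kleisli_map C D J M \<phi>) (kleisli_map C D J M' \<psi>)"
  using relative_monad_functor[OF M, THEN functor_cat(2)]
  by (auto simp: kleisli_map_def functor_comp_def fun_eq_iff Hom_iff rmon_morphism_Mor[OF p] rmon_morphism_Mor[OF q])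


section \<open>Isomorphisms of categories\<close>

definition iso_functor :: "('o, 'm) cat \<Rightarrow> ('p, 'n) cat \<Rightarrow> ('o, 'm, 'p, 'n) fnct \<Rightarrow> bool" where
  "iso_functor C D \<Phi> \<longleftrightarrow> is_functor C D \<Phi> \<and>
     bij_betw (FOb \<Phi>) (Ob C) (Ob D) \<and> bij_betw (FMor \<Phi>) (Mor C) (Mor D)"

definition functor_inv ::
  "('o, 'm) cat \<Rightarrow> ('p, 'n) cat \<Rightarrow> ('o, 'm, 'p, 'n) fnct \<Rightarrow> ('p, 'n, 'o, 'm) fnct" where
  "functor_inv C D \<Phi> = \<lparr>FOb = (\<lambda>Y\<in>Ob D. inv_into (Ob C) (FOb \<Phi>) Y),
     FMor = (\<lambda>g\<in>Mor D. inv_into (Mor C) (FMor \<Phi>) g)\<rparr>"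

context
  fixes C :: "('o, 'm) cat" and D :: "('p, 'n) cat" and \<Phi>
  assumes \<Phi>: "iso_functor C D \<Phi>"
begin

lemma iso_functor_functor: "is_functor C D \<Phi>"
  using \<Phi> by (simp add: iso_functor_def)

lemma functor_inv_left:
  "X \<in> Ob C \<Longrightarrow> FOb (functor_inv C D \<Phi>) (FOb \<Phi> X) = X"
  "f \<in> Mor C \<Longrightarrow> FMor (functor_inv C D \<Phi>) (FMor \<Phi> f) = f"
  using \<Phi> by (auto simp: iso_functor_def functor_inv_def bij_betw_def)

lemma functor_inv_right:
  "Y \<in> Ob D \<Longrightarrow> FOb (functor_inv C D \<Phi>) Y \<in> Ob C"
  "g \<in> Mor D \<Longrightarrow> FMor (functor_inv C D \<Phi>) g \<in> Mor C"
  "Y \<in> Ob D \<Longrightarrow> FOb \<Phi> (FOb (functor_inv C D \<Phi>) Y) = Y"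
  "g \<in> Mor D \<Longrightarrow> FMor \<Phi> (FMor (functor_inv C D \<Phi>) g) = g"
  using \<Phi> by (auto simp: iso_functor_def functor_inv_def bij_betw_def f_inv_into_f
    intro: inv_into_into)

text \<open>\<open>\<Phi>\<close> is injective on objects and on morphisms, so sources, targets,
  identities and composites of inverse images can be compared after applying
  \<open>\<Phi>\<close>.\<close>

lemma functor_inv_functor: "is_functor D C (functor_inv C D \<Phi>)"
proof -
  note F = iso_functor_functor
  note [simp] = functor_cat[OF F] functor_Mor[OF F] functor_Ob[OF F] functor_inv_right functor_inv_left
  have ob: "X = Y" if "X \<in> Ob C" "Y \<in> Ob C" "FOb \<Phi> X = FOb \<Phi> Y" for X Y
    using that functor_inv_left(1) by metis
  have mor: "f = g" if "f \<in> Mor C" "g \<in> Mor C" "FMor \<Phi> f = FMor \<Phi> g" for f g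
    using that functor_inv_left(2) by metis
  have st: "Src C (FMor (functor_inv C D \<Phi>) g) = FOb (functor_inv C D \<Phi>) (Src D g)"
    "Tgt C (FMor (functor_inv C D \<Phi>) g) = FOb (functor_inv C D \<Phi>) (Tgt D g)" if "g \<in> Mor D" for g
    using that functor_Mor(2,3)[OF F, of "FMor (functor_inv C D \<Phi>) g"] by (auto intro!: ob)
  show ?thesis
    unfolding is_functor_def
  proof (intro conjI ballI impI)
    show "FOb (functor_inv C D \<Phi>) \<in> Ob D \<rightarrow>\<^sub>E Ob C"
      "FMor (functor_inv C D \<Phi>) \<in> extensional (Mor D)"
      by (auto simp: PiE_def functor_inv_def) (use functor_inv_right(1) in \<open>auto simp: functor_inv_def\<close>)
    show "FMor (functor_inv C D \<Phi>) (Ident D X) = Ident C (FOb (functor_inv C D \<Phi>) X)" if "X \<in> Ob D" for X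
      by (rule mor) (use that in \<open>simp_all add: functor_Ident[OF F]\<close>)
    show "FMor (functor_inv C D \<Phi>) (Comp D f g)
      = Comp C (FMor (functor_inv C D \<Phi>) f) (FMor (functor_inv C D \<Phi>) g)"
      if "f \<in> Mor D" "g \<in> Mor D" "Tgt D f = Src D g" for f g
      by (rule mor) (use that in \<open>simp_all add: functor_Comp[OF F] st\<close>)
  qed (simp_all add: Hom_iff st)
qed

lemma functor_comp_inv_right: "functor_comp C \<Phi> (functor_inv C D \<Phi>) = functor_id C"
  by (rule functor_eqI[OF functor_comp_functor[OF iso_functor_functor functor_inv_functor] functor_id_functor])
    (auto simp: functor_inv_left functor_cat[OF iso_functor_functor])

lemma functor_comp_inv_left: "functor_comp D (functor_inv C D \<Phi>) \<Phi> = functor_id D"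
  by (rule functor_eqI[OF functor_comp_functor[OF functor_inv_functor iso_functor_functor] functor_id_functor])
    (auto simp: functor_inv_right functor_cat[OF iso_functor_functor])

end

text \<open>The images of \<open>p\<close> and \<open>e\<close> inherit the structure of
  \<open>C\<close>. This moves a category over arbitrary types into the type of the
  universe.\<close>

lemma iso_functor_transport:
  assumes C: "is_category C" and p: "inj_on p (Ob C)" and e: "inj_on e (Mor C)"
  shows "\<exists>D \<Phi>. iso_functor C D \<Phi> \<and> Ob D = p ` Ob C \<and> Mor D = e ` Mor C"
proof -
  note [simp] = C
  let ?p = "inv_into (Ob C) p" and ?e = "inv_into (Mor C) e"
  have [simp]: "X \<in> Ob C \<Longrightarrow> ?p (p X) = X" "f \<in> Mor C \<Longrightarrow> ?e (e f) = f" for X f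
    using p e by auto
  have [simp]: "X \<in> Ob C \<Longrightarrow> Y \<in> Ob C \<Longrightarrow> p X = p Y \<longleftrightarrow> X = Y" for X Y
    using p by (auto simp: inj_on_def)
  \<comment> \<open>Arguments are decoded, the operation of \<open>C\<close> is applied, and the
    result is encoded again. Composability is tested in \<open>C\<close>; by injectivity of
    \<open>p\<close> it agrees with composability in \<open>D\<close>, as the default value
    \<open>undefined\<close> requires.\<close>
  define D where "D = \<lparr>Ob = p ` Ob C, Mor = e ` Mor C,
    Src = (\<lambda>x\<in>e ` Mor C. p (Src C (?e x))), Tgt = (\<lambda>x\<in>e ` Mor C. p (Tgt C (?e x))),
    Ident = (\<lambda>Y\<in>p ` Ob C. e (Ident C (?p Y))),
    Comp = (\<lambda>x y. if x \<in> e ` Mor C \<and> y \<in> e ` Mor C \<and> Tgt C (?e x) = Src C (?e y)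
      then e (Comp C (?e x) (?e y)) else undefined)\<rparr>"
  have D [simp]: "Ob D = p ` Ob C" "Mor D = e ` Mor C"
    "f \<in> Mor C \<Longrightarrow> Src D (e f) = p (Src C f)" "f \<in> Mor C \<Longrightarrow> Tgt D (e f) = p (Tgt C f)"
    "X \<in> Ob C \<Longrightarrow> Ident D (p X) = e (Ident C X)"
    "f \<in> Mor C \<Longrightarrow> g \<in> Mor C \<Longrightarrow> Tgt C f = Src C g \<Longrightarrow> Comp D (e f) (e g) = e (Comp C f g)"
    for f g X
    by (auto simp: D_def)
  have cat: "is_category D"
    unfolding is_category_def
  proof (intro conjI ballI allI impI)
    show "Src D \<in> Mor D \<rightarrow>\<^sub>E Ob D" "Tgt D \<in> Mor D \<rightarrow>\<^sub>E Ob D" "Ident D \<in> extensional (Ob D)"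
      by (auto simp: D_def)
    show "Comp D f g = undefined" if "\<not> (f \<in> Mor D \<and> g \<in> Mor D \<and> Tgt D f = Src D g)" for f g
      using that by (auto simp: D_def)
    show "Comp D f g \<in> Hom D (Src D f) (Tgt D g)" if "f \<in> Mor D \<and> g \<in> Mor D \<and> Tgt D f = Src D g" for f g
      using that by (auto simp: Hom_iff)
    show "Comp D (Comp D f g) h = Comp D f (Comp D g h)"
      if "f \<in> Mor D" "g \<in> Mor D" "h \<in> Mor D" "Tgt D f = Src D g \<and> Tgt D g = Src D h" for f g h
      using that by auto
  qed (auto simp: Hom_iff)
  define \<Phi> where "\<Phi> = \<lparr>FOb = restrict p (Ob C), FMor = restrict e (Mor C)\<rparr>"
  have "is_functor C D \<Phi>"
    unfolding is_functor_def using cat by (auto simp: \<Phi>_def Hom_iff)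
  moreover have "bij_betw (FOb \<Phi>) (Ob C) (Ob D)" "bij_betw (FMor \<Phi>) (Mor C) (Mor D)"
    using p e by (auto simp: \<Phi>_def bij_betw_def inj_on_def)
  ultimately have "iso_functor C D \<Phi>" by (simp add: iso_functor_def)
  then show ?thesis using D(1,2) by blast
qed


section \<open>Lawvere theories\<close>

lemma FF_category: "is_category FF"
  by (simp add: FF_def fun_cat_category)

lemma FF_simps [simp]:
  "Ob FF = UNIV"
  "Mor FF = {(m, n, f). f \<in> stn m \<rightarrow>\<^sub>E stn n}"
  "Ident FF m = (m, m, \<lambda>x\<in>stn m. x)"
  "f \<in> stn m \<rightarrow>\<^sub>E stn n \<Longrightarrow> Src FF (m, n, f) = m"
  "f \<in> stn m \<rightarrow>\<^sub>E stn n \<Longrightarrow> Tgt FF (m, n, f) = n"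
  "f \<in> stn k \<rightarrow>\<^sub>E stn m \<Longrightarrow> g \<in> stn m \<rightarrow>\<^sub>E stn n \<Longrightarrow> Comp FF (k, m, f) (m, n, g) = (k, n, \<lambda>x\<in>stn k. g (f x))"
  by (simp_all add: FF_def)

lemma Hom_FF: "a \<in> Hom FF m n \<longleftrightarrow> (\<exists>f\<in>stn m \<rightarrow>\<^sub>E stn n. a = (m, n, f))"
  by (simp add: FF_def Hom_fun_cat)

lemma mem_stn [simp]: "i \<in> stn n \<longleftrightarrow> i < n"
  by (simp add: stn_def)

lemma ii_Hom: "ii0 m n \<in> Hom FF m (m + n)" "ii1 m n \<in> Hom FF n (m + n)"
  by (auto simp: ii0_def ii1_def Hom_FF)

section \<open>Push-outs under an initial object as coproducts\<close>

lemma initial_arrow_Hom: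
  assumes "is_initial C I" "X \<in> Ob C"
  shows "initial_arrow C I X \<in> Hom C I X"
  unfolding initial_arrow_def by (rule theI') (use assms in \<open>auto simp: is_initial_def\<close>)

lemma initial_Hom_unique:
  assumes "is_initial C I" "X \<in> Ob C" "f \<in> Hom C I X" "g \<in> Hom C I X"
  shows "f = g"
  using assms by (auto simp: is_initial_def)

text \<open>The apex is read off as the target of \<open>h\<close>; wherever this is applied,
  \<open>k\<close> has the same target.\<close>

definition is_coproduct :: "('o, 'm) cat \<Rightarrow> 'm \<Rightarrow> 'm \<Rightarrow> bool" where
  "is_coproduct C h k \<longleftrightarrow> (\<forall>Q\<in>Ob C. \<forall>u\<in>Hom C (Src C h) Q. \<forall>v\<in>Hom C (Src C k) Q.
     \<exists>!w. w \<in> Hom C (Tgt C h) Q \<and> Comp C h w = u \<and> Comp C k w = v)"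

text \<open>Parallel morphisms out of an initial object are equal, so the square commutes and every
  pair \<open>u\<close>, \<open>v\<close> satisfies the compatibility condition of the
  push-out.\<close>

lemma is_pushout_initial_iff:
  assumes C: "is_category C" and I: "is_initial C I" and h: "h \<in> Hom C B P" and k: "k \<in> Hom C B' P"
  shows "is_pushout C (initial_arrow C I B) (initial_arrow C I B') h k \<longleftrightarrow> is_coproduct C h k"
proof -
  note ob = Hom_Ob[OF C h] Hom_Ob[OF C k]
  have fg: "initial_arrow C I B \<in> Hom C I B" "initial_arrow C I B' \<in> Hom C I B'"
    using initial_arrow_Hom[OF I] ob by auto
  have eq: "Comp C (initial_arrow C I B) u = Comp C (initial_arrow C I B') v"
    if "u \<in> Hom C B Q" "v \<in> Hom C B' Q" for u v Q
    by (rule initial_Hom_unique[OF I, of Q]) (use that fg Hom_Ob[OF C] Comp_Hom[OF C] in blast)+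
  have hk: "Src C h = B" "Src C k = B'" "Tgt C h = P" using h k by (auto simp: Hom_iff)
  show ?thesis
  proof
    assume "is_pushout C (initial_arrow C I B) (initial_arrow C I B') h k"
    then show "is_coproduct C h k"
      unfolding is_pushout_def is_coproduct_def hk using fg h k eq by (auto simp: Hom_iff)
  next
    assume co: "is_coproduct C h k"
    show "is_pushout C (initial_arrow C I B) (initial_arrow C I B') h k"
      unfolding is_pushout_def using co fg h k eq[OF h k]
      by (intro exI[of _ I] exI[of _ B] exI[of _ B'] exI[of _ P]) (simp add: is_coproduct_def hk)
  qed
qed

text \<open>The working form of the definition, free of \<open>initial_arrow\<close> and its
  definite description.\<close>

lemma lawvere_theory_iff:
  "lawvere_theory T L \<longleftrightarrow> is_functor FF T L \<and> bij_betw (FOb L) UNIV (Ob T) \<and>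
    is_initial T (FOb L 0) \<and> (\<forall>m n. is_coproduct T (FMor L (ii0 m n)) (FMor L (ii1 m n)))"
proof -
  have "is_pushout T (initial_arrow T (FOb L 0) (FOb L m)) (initial_arrow T (FOb L 0) (FOb L n))
      (FMor L (ii0 m n)) (FMor L (ii1 m n)) \<longleftrightarrow> is_coproduct T (FMor L (ii0 m n)) (FMor L (ii1 m n))"
    if "is_functor FF T L" "is_initial T (FOb L 0)" for m n
    by (rule is_pushout_initial_iff[OF functor_cat(2)[OF that(1)] that(2)])
      (rule functor_Hom[OF that(1) ii_Hom(1)] functor_Hom[OF that(1) ii_Hom(2)])+
  then show ?thesis
    using functor_cat[of FF T L] by (auto simp: lawvere_theory_def)
qed

text \<open>Universal properties cross the isomorphism: the data in \<open>T'\<close> are sent back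
  by the inverse functor, the problem is solved in \<open>T\<close>, and the solution is sent
  forward; uniqueness is argued likewise.\<close>

lemma lawvere_theory_iso_functor:
  assumes T: "lawvere_theory T L" and \<Phi>: "iso_functor T T' \<Phi>"
  shows "lawvere_theory T' (functor_comp FF L \<Phi>)"
proof -
  have L: "is_functor FF T L" using T by (simp add: lawvere_theory_def)
  note F = iso_functor_functor[OF \<Phi>] and G = functor_inv_functor[OF \<Phi>]
  let ?\<Psi> = "functor_inv T T' \<Phi>"
  note inv = functor_inv_left[OF \<Phi>] functor_inv_right[OF \<Phi>]
  note Lob = functor_Ob[OF L, simplified]
  have "is_initial T' (FOb \<Phi> (FOb L 0))"
    unfolding is_initial_def
  proof (intro conjI ballI)
    fix X assume X: "X \<in> Ob T'"
    then have "\<exists>!f. f \<in> Hom T (FOb L 0) (FOb ?\<Psi> X)"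
      using T inv by (auto simp: lawvere_theory_def is_initial_def)
    then obtain f where f: "f \<in> Hom T (FOb L 0) (FOb ?\<Psi> X)"
      and u: "\<And>g. g \<in> Hom T (FOb L 0) (FOb ?\<Psi> X) \<Longrightarrow> g = f" by auto
    show "\<exists>!f. f \<in> Hom T' (FOb \<Phi> (FOb L 0)) X"
    proof
      show "FMor \<Phi> f \<in> Hom T' (FOb \<Phi> (FOb L 0)) X"
        using functor_Hom[OF F f] X by (simp add: inv)
      fix g assume g: "g \<in> Hom T' (FOb \<Phi> (FOb L 0)) X"
      then have "FMor ?\<Psi> g = f"
        using functor_Hom[OF G g] by (intro u) (simp add: inv Lob)
      then show "g = FMor \<Phi> f" using inv(6)[of g] g by (auto simp: Hom_iff)
    qed
  qed (simp add: functor_Ob[OF F] Lob)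
  moreover have "is_coproduct T' (FMor \<Phi> (FMor L (ii0 m n))) (FMor \<Phi> (FMor L (ii1 m n)))" for m n
  proof -
    have h: "FMor L (ii0 m n) \<in> Hom T (FOb L m) (FOb L (m + n))"
      and k: "FMor L (ii1 m n) \<in> Hom T (FOb L n) (FOb L (m + n))"
      using functor_Hom[OF L] ii_Hom by blast+
    have co: "is_coproduct T (FMor L (ii0 m n)) (FMor L (ii1 m n))"
      using T by (simp add: lawvere_theory_iff)
    show ?thesis
      unfolding is_coproduct_def
    proof (intro ballI)
      fix Q u v assume Q: "Q \<in> Ob T'"
        and u': "u \<in> Hom T' (Src T' (FMor \<Phi> (FMor L (ii0 m n)))) Q"
        and v': "v \<in> Hom T' (Src T' (FMor \<Phi> (FMor L (ii1 m n)))) Q"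
      have u: "u \<in> Hom T' (FOb \<Phi> (FOb L m)) Q" and v: "v \<in> Hom T' (FOb \<Phi> (FOb L n)) Q"
        using u' v' functor_Hom[OF F h] functor_Hom[OF F k] by (auto simp: Hom_iff)
      have "\<exists>!w. w \<in> Hom T (FOb L (m + n)) (FOb ?\<Psi> Q) \<and>
          Comp T (FMor L (ii0 m n)) w = FMor ?\<Psi> u \<and> Comp T (FMor L (ii1 m n)) w = FMor ?\<Psi> v"
        using co h k functor_Hom[OF G u] functor_Hom[OF G v] functor_Ob[OF G Q]
        by (auto simp: is_coproduct_def Hom_iff inv Lob)
      then obtain w where w: "w \<in> Hom T (FOb L (m + n)) (FOb ?\<Psi> Q)"
          "Comp T (FMor L (ii0 m n)) w = FMor ?\<Psi> u" "Comp T (FMor L (ii1 m n)) w = FMor ?\<Psi> v"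
        and uniq: "\<And>w'. w' \<in> Hom T (FOb L (m + n)) (FOb ?\<Psi> Q) \<Longrightarrow>
          Comp T (FMor L (ii0 m n)) w' = FMor ?\<Psi> u \<Longrightarrow> Comp T (FMor L (ii1 m n)) w' = FMor ?\<Psi> v \<Longrightarrow> w' = w"
        by blast
      have uv: "FMor \<Phi> (FMor ?\<Psi> u) = u" "FMor \<Phi> (FMor ?\<Psi> v) = v"
        using u v inv by (auto simp: Hom_iff)
      have tgt: "Tgt T' (FMor \<Phi> (FMor L (ii0 m n))) = FOb \<Phi> (FOb L (m + n))"
        using functor_Hom[OF F h] by (auto simp: Hom_iff)
      show "\<exists>!w. w \<in> Hom T' (Tgt T' (FMor \<Phi> (FMor L (ii0 m n)))) Q \<and>
          Comp T' (FMor \<Phi> (FMor L (ii0 m n))) w = u \<and> Comp T' (FMor \<Phi> (FMor L (ii1 m n))) w = v"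
        unfolding tgt
      proof (intro ex1I[of _ "FMor \<Phi> w"] conjI)
        show "FMor \<Phi> w \<in> Hom T' (FOb \<Phi> (FOb L (m + n))) Q"
          using functor_Hom[OF F w(1)] Q by (simp add: inv)
        show "Comp T' (FMor \<Phi> (FMor L (ii0 m n))) (FMor \<Phi> w) = u"
          "Comp T' (FMor \<Phi> (FMor L (ii1 m n))) (FMor \<Phi> w) = v"
          using functor_Comp_Hom[OF F h w(1)] functor_Comp_Hom[OF F k w(1)] w(2,3) uv by simp_all
        fix w' assume w': "w' \<in> Hom T' (FOb \<Phi> (FOb L (m + n))) Q \<and>
          Comp T' (FMor \<Phi> (FMor L (ii0 m n))) w' = u \<and> Comp T' (FMor \<Phi> (FMor L (ii1 m n))) w' = v"
        have "FMor ?\<Psi> w' = w"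
        proof (rule uniq)
          show "FMor ?\<Psi> w' \<in> Hom T (FOb L (m + n)) (FOb ?\<Psi> Q)"
            using functor_Hom[OF G w'[THEN conjunct1]] by (simp add: inv Lob)
          show "Comp T (FMor L (ii0 m n)) (FMor ?\<Psi> w') = FMor ?\<Psi> u"
            using functor_Comp_Hom[OF G functor_Hom[OF F h] w'[THEN conjunct1]] w' h
            by (simp add: inv Hom_iff)
          show "Comp T (FMor L (ii1 m n)) (FMor ?\<Psi> w') = FMor ?\<Psi> v"
            using functor_Comp_Hom[OF G functor_Hom[OF F k] w'[THEN conjunct1]] w' k
            by (simp add: inv Hom_iff)
        qed
        then show "w' = FMor \<Phi> w" using inv(6)[of w'] w' by (auto simp: Hom_iff)
      qed
    qed
  qed
  moreover have "bij_betw (FOb (functor_comp FF L \<Phi>)) UNIV (Ob T')"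
  proof -
    have "FOb (functor_comp FF L \<Phi>) = FOb \<Phi> \<circ> FOb L" by (auto simp: functor_comp_def)
    then show ?thesis
      using T \<Phi> by (auto simp: lawvere_theory_iff iso_functor_def intro: bij_betw_trans)
  qed
  moreover have "ii0 m n \<in> Mor FF" "ii1 m n \<in> Mor FF" for m n
    using ii_Hom by (auto simp only: Hom_iff)
  ultimately show ?thesis
    using functor_comp_functor[OF L F] by (simp add: lawvere_theory_iff del: FF_simps(2))
qed

lemma LW_simps:
  "Ob (LW elts U) =
    {(T, L). lawvere_theory T L \<and> in_universe elts U (Ob T) \<and> in_universe elts U (Mor T)}"
  "(T, L) \<in> Ob (LW elts U) \<Longrightarrow> Ident (LW elts U) (T, L) = ((T, L), (T, L), functor_id T)"
  by (simp_all add: LW_def hom_cat_homset_cat)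

lemma Hom_LW:
  "a \<in> Hom (LW elts U) (T, L) (T', L') \<longleftrightarrow> (T, L) \<in> Ob (LW elts U) \<and> (T', L') \<in> Ob (LW elts U) \<and>
    (\<exists>G. is_functor T T' G \<and> functor_comp FF L G = L' \<and> a = ((T, L), (T', L'), G))"
  by (auto simp: LW_def hom_cat_homset_cat Hom_homset_cat)

lemma Comp_LW:
  assumes "(T, L) \<in> Ob (LW elts U)" "(T', L') \<in> Ob (LW elts U)" "(T'', L'') \<in> Ob (LW elts U)"
    "is_functor T T' G" "functor_comp FF L G = L'" "is_functor T' T'' H" "functor_comp FF L' H = L''"
  shows "Comp (LW elts U) ((T, L), (T', L'), G) ((T', L'), (T'', L''), H)
    = ((T, L), (T'', L''), functor_comp T G H)"
  using assms unfolding LW_def hom_cat_homset_cat by (subst homset_cat_Comp) auto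

lemma LW_category: "is_category (LW elts U)"
  unfolding LW_def hom_cat_homset_cat
proof (rule homset_cat_category, goal_cases)
  case (1 X)
  then show ?case
    by (auto simp: lawvere_theory_def functor_id_functor functor_comp_id_right)
next
  case (2 X Y Z f g)
  then show ?case
    by (auto simp: lawvere_theory_def functor_comp_functor simp flip: functor_comp_assoc)
qed (auto simp: functor_comp_id_left functor_comp_id_right functor_comp_assoc)


section \<open>Small sets\<close>

locale universe =
  fixes elts :: "'v \<Rightarrow> 'v set" and U :: "'v set"
  assumes universe: "grothendieck_universe elts U"
begin

abbreviation small :: "'v set \<Rightarrow> bool" where "small \<equiv> in_universe elts U"

abbreviation elem :: "'v set \<Rightarrow> 'v" where "elem \<equiv> as_element elts U"

lemma elem:
  assumes "small A"
  shows "elem A \<in> U" "elts (elem A) = A"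
proof -
  have "\<exists>!x. x \<in> U \<and> elts x = A"
    using assms universe by (auto simp: in_universe_def grothendieck_universe_def inj_on_def)
  from theI'[OF this] show "elem A \<in> U" "elts (elem A) = A"
    unfolding as_element_def by auto
qed

lemma elem_elts: "x \<in> U \<Longrightarrow> elem (elts x) = x"
  using universe elem[of "elts x"] by (auto simp: in_universe_def grothendieck_universe_def inj_on_def)

lemma small_elts: "x \<in> U \<Longrightarrow> small (elts x)"
  by (auto simp: in_universe_def)

lemma small_subset_U: "small A \<Longrightarrow> A \<subseteq> U"
  using universe by (auto simp: in_universe_def grothendieck_universe_def)

lemma elem_inj: "small A \<Longrightarrow> small B \<Longrightarrow> elem A = elem B \<Longrightarrow> A = B"
  using elem by metis

lemma
  shows universe_pair: "x \<in> U \<Longrightarrow> y \<in> U \<Longrightarrow> \<exists>z\<in>U. elts z = {x, y}"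
    and universe_Pow: "x \<in> U \<Longrightarrow> \<exists>p\<in>U. elts ` elts p = Pow (elts x)"
    and universe_UN: "x \<in> U \<Longrightarrow> a \<in> elts x \<rightarrow> U \<Longrightarrow> \<exists>u\<in>U. elts u = (\<Union>i\<in>elts x. elts (a i))"
  using universe unfolding grothendieck_universe_def by simp_all

text \<open>The power set clause yields an element \<open>p\<close> whose elements name the subsets
  of \<open>A\<close>. Extensionality identifies these names with the values of \<open>elem\<close>,
  and transitivity puts them in \<open>U\<close>, so every subset of \<open>A\<close> is
  small.\<close>

lemma small_Pow:
  assumes "small A"
  shows "small (elem ` Pow A)" and "B \<subseteq> A \<Longrightarrow> small B"
proof -
  obtain x where x: "x \<in> U" "elts x = A" using assms by (auto simp: in_universe_def)
  obtain p where p: "p \<in> U" "elts ` elts p = Pow A"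
    using universe_Pow[OF x(1)] x(2) by auto
  have pU: "elts p \<subseteq> U" using small_subset_U[OF small_elts[OF p(1)]] .
  have "elem ` Pow A = elts p"
    unfolding p(2)[symmetric] image_image using pU by (force simp: elem_elts)
  then show "small (elem ` Pow A)" using p(1) by (auto simp: in_universe_def)
  show "small B" if "B \<subseteq> A"
  proof -
    have "B \<in> elts ` elts p" using that p by simp
    then show ?thesis using pU by (auto simp: in_universe_def)
  qed
qed

lemma small_insert2: "x \<in> U \<Longrightarrow> y \<in> U \<Longrightarrow> small {x, y}"
  using universe_pair unfolding in_universe_def .

lemma small_UN:
  assumes "small A" "\<And>a. a \<in> A \<Longrightarrow> small (B a)"
  shows "small (\<Union>a\<in>A. B a)"
proof -
  obtain x where x: "x \<in> U" "elts x = A" using assms(1) by (auto simp: in_universe_def)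
  have "(\<lambda>a. elem (B a)) \<in> elts x \<rightarrow> U" using assms(2) elem x by auto
  then obtain u where "u \<in> U" "elts u = (\<Union>a\<in>elts x. elts (elem (B a)))"
    using universe_UN[OF x(1)] by blast
  moreover have "(\<Union>a\<in>elts x. elts (elem (B a))) = (\<Union>a\<in>A. B a)"
    using x assms(2) elem by auto
  ultimately show ?thesis by (auto simp: in_universe_def)
qed

text \<open>Replacement comes from the union clause, applied to the family of singletons of the
  values.\<close>

lemma small_image:
  assumes "small A" "f ` A \<subseteq> U"
  shows "small (f ` A)"
proof -
  have "small {f a}" if "a \<in> A" for a
    using small_insert2[of "f a" "f a"] that assms(2) by auto
  then have "small (\<Union>a\<in>A. {f a})"
    by (rule small_UN[OF assms(1)])
  then show ?thesis by (simp add: UNION_singleton_eq_range)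
qed

section \<open>Kuratowski pairs and sets that can be encoded in the universe\<close>

definition kpair :: "'v \<Rightarrow> 'v \<Rightarrow> 'v" where
  "kpair x y = elem {elem {x, x}, elem {x, y}}"

lemma kpair_U: "x \<in> U \<Longrightarrow> y \<in> U \<Longrightarrow> kpair x y \<in> U"
  unfolding kpair_def by (intro elem small_insert2)

lemma kpair_inj:
  assumes "x \<in> U" "y \<in> U" "x' \<in> U" "y' \<in> U" "kpair x y = kpair x' y'"
  shows "x = x' \<and> y = y'"
proof -
  have "{elem {x, x}, elem {x, y}} = {elem {x', x'}, elem {x', y'}}"
    by (rule elem_inj[OF _ _ assms(5)[unfolded kpair_def]]) (intro small_insert2 elem assms)+
  moreover have "elem {a, b} = elem {c, d} \<longleftrightarrow> {a, b} = {c, d}"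
    if "a \<in> U" "b \<in> U" "c \<in> U" "d \<in> U" for a b c d
    using elem_inj[of "{a, b}" "{c, d}"] that small_insert2 by metis
  ultimately show ?thesis using assms(1-4) by (auto simp only: doubleton_eq_iff)
qed

text \<open>Smallness for sets over other types, such as pairs and functions of HOL, whose members
  are not literally elements of \<open>U\<close>.\<close>

definition essentially_small :: "'a set \<Rightarrow> bool" where
  "essentially_small A \<longleftrightarrow> (\<exists>e. inj_on e A \<and> small (e ` A))"

lemma essentially_small_small: "small A \<Longrightarrow> essentially_small A"
  unfolding essentially_small_def by (rule exI[of _ id]) auto

lemma essentially_small_inj:
  assumes "essentially_small B" "inj_on g A" "g ` A \<subseteq> B"
  shows "essentially_small A"
proof -
  obtain e where e: "inj_on e B" "small (e ` B)" using assms by (auto simp: essentially_small_def)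
  have "small ((e \<circ> g) ` A)" by (rule small_Pow(2)[OF e(2)]) (use assms(3) in auto)
  moreover have "inj_on (e \<circ> g) A"
    using assms e by (meson comp_inj_on inj_on_subset)
  ultimately show ?thesis by (auto simp: essentially_small_def)
qed

text \<open>A pair is encoded by the Kuratowski pair of the codes of its entries, and the set of all
  codes is a small union of small images.\<close>

lemma essentially_small_Sigma:
  assumes A: "essentially_small A" and B: "\<And>a. a \<in> A \<Longrightarrow> essentially_small (B a)"
  shows "essentially_small (Sigma A B)"
proof -
  obtain e where e: "inj_on e A" "small (e ` A)" using A by (auto simp: essentially_small_def)
  obtain d where d: "\<And>a. a \<in> A \<Longrightarrow> inj_on (d a) (B a) \<and> small (d a ` B a)"
    using B by (simp add: essentially_small_def) metis
  let ?f = "\<lambda>(a, b). kpair (e a) (d a b)"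
  have U: "a \<in> A \<Longrightarrow> e a \<in> U" "a \<in> A \<Longrightarrow> b \<in> B a \<Longrightarrow> d a b \<in> U" for a b
    using small_subset_U[OF e(2)] d small_subset_U by blast+
  have "inj_on ?f (Sigma A B)"
  proof (rule inj_onI, clarify)
    fix a b a' b' assume *: "a \<in> A" "b \<in> B a" "a' \<in> A" "b' \<in> B a'" "kpair (e a) (d a b) = kpair (e a') (d a' b')"
    then have "e a = e a'" "d a b = d a' b'" using kpair_inj[of "e a" "d a b" "e a'" "d a' b'"] U by auto
    then show "a = a' \<and> b = b'" using * e(1) d[of a] by (auto simp: inj_on_def)
  qed
  moreover have "small (?f ` Sigma A B)"
  proof -
    \<comment> \<open>The union has to be indexed by a small set, hence by the codes of
      \<open>A\<close> rather than by \<open>A\<close>; \<open>inv_into\<close> recovers the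
      index.\<close>
    have "small (\<Union>x\<in>e ` A. kpair x ` d (inv_into A e x) ` B (inv_into A e x))"
    proof (rule small_UN[OF e(2)], clarify)
      fix a assume "a \<in> A"
      then show "small (kpair (e a) ` d (inv_into A e (e a)) ` B (inv_into A e (e a)))"
        using d[of a] e(1) U by (intro small_image) (auto intro!: kpair_U)
    qed
    also have "(\<Union>x\<in>e ` A. kpair x ` d (inv_into A e x) ` B (inv_into A e x)) = ?f ` Sigma A B"
      using e(1) by force
    finally show ?thesis .
  qed
  ultimately show ?thesis by (auto simp: essentially_small_def)
qed

text \<open>A subset is encoded by the element of \<open>U\<close> that consists of the codes of its
  members. Such elements form a subset of the small set of names provided by
  \<open>small_Pow\<close>.\<close>

lemma essentially_small_Pow:
  assumes "essentially_small A"
  shows "essentially_small (Pow A)"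
proof -
  obtain e where e: "inj_on e A" "small (e ` A)" using assms by (auto simp: essentially_small_def)
  have s: "small (e ` X)" if "X \<subseteq> A" for X using small_Pow(2)[OF e(2)] that by blast
  have "inj_on (\<lambda>X. elem (e ` X)) (Pow A)"
    using e(1) s elem_inj by (intro inj_onI) (meson PowD inj_on_image_eq_iff)
  moreover have "small ((\<lambda>X. elem (e ` X)) ` Pow A)"
    by (rule small_Pow(2)[OF small_Pow(1)[OF e(2)]]) auto
  ultimately show ?thesis by (auto simp: essentially_small_def)
qed

text \<open>A function is encoded by its graph, a subset of the product; extensionality makes the
  graph determine the function.\<close>

lemma essentially_small_PiE:
  assumes "essentially_small A" "essentially_small B"
  shows "essentially_small (A \<rightarrow>\<^sub>E B)"
proof (rule essentially_small_inj)
  show "essentially_small (Pow (A \<times> B))"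
    using assms by (intro essentially_small_Pow essentially_small_Sigma)
  show "inj_on (\<lambda>f. (\<lambda>x. (x, f x)) ` A) (A \<rightarrow>\<^sub>E B)"
  proof (rule inj_onI)
    fix f g assume fg: "f \<in> A \<rightarrow>\<^sub>E B" "g \<in> A \<rightarrow>\<^sub>E B" and eq: "(\<lambda>x. (x, f x)) ` A = (\<lambda>x. (x, g x)) ` A"
    show "f = g"
    proof (rule PiE_ext[OF fg])
      fix x assume "x \<in> A"
      then have "(x, f x) \<in> (\<lambda>x. (x, g x)) ` A" using eq by blast
      then show "f x = g x" by auto
    qed
  qed
qed auto

end


section \<open>The Kleisli category of a monad relative to the inclusion of finite sets\<close>

text \<open>Points stand for the elements of \<open>stn n\<close>. Under \<open>L\<close> they
  become the injections of the copower \<open>L n\<close> of \<open>L 1\<close>.\<close>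

definition point :: "nat \<Rightarrow> nat \<Rightarrow> fmor" where
  "point n i = (1, n, \<lambda>j\<in>stn 1. i)"

lemma point_Hom: "i < n \<Longrightarrow> point n i \<in> Hom FF 1 n"
  by (auto simp: point_def Hom_FF)

lemma point_Comp: "i < m \<Longrightarrow> f \<in> stn m \<rightarrow>\<^sub>E stn n \<Longrightarrow> Comp FF (point m i) (m, n, f) = point n (f i)"
  unfolding point_def by (subst FF_simps) (auto simp: fun_eq_iff)

lemma point_ii:
  "i < m \<Longrightarrow> Comp FF (point m i) (ii0 m n) = point (m + n) i"
  "i < n \<Longrightarrow> Comp FF (point n i) (ii1 m n) = point (m + n) (m + i)"
  unfolding ii0_def ii1_def by (subst point_Comp; auto)+

lemma ii1_point: "ii1 m 1 = point (m + 1) m"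
  by (auto simp: ii1_def point_def fun_eq_iff)

definition app :: "'v \<times> 'v \<times> ('v \<Rightarrow> 'v) \<Rightarrow> 'v \<Rightarrow> 'v" where
  "app a = snd (snd a)"

locale universe_nat = universe elts U for elts :: "'v \<Rightarrow> 'v set" and U +
  fixes \<nu> :: "nat \<Rightarrow> 'v"
  assumes inj_\<nu>: "inj \<nu>" and small_range_\<nu>: "small (range \<nu>)"
begin

section \<open>Morphisms of Sets(U) handled elementwise, and the functor from finite sets\<close>

abbreviation S :: "('v, 'v \<times> 'v \<times> ('v \<Rightarrow> 'v)) cat" where "S \<equiv> Sets elts U"

abbreviation J :: "(nat, fmor, 'v, 'v \<times> 'v \<times> ('v \<Rightarrow> 'v)) fnct" where "J \<equiv> Jf elts U \<nu>"

abbreviation st :: "nat \<Rightarrow> 'v" where "st n \<equiv> elem (\<nu> ` stn n)"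

definition arr :: "'v \<Rightarrow> 'v \<Rightarrow> ('v \<Rightarrow> 'v) \<Rightarrow> 'v \<times> 'v \<times> ('v \<Rightarrow> 'v)" where
  "arr X Y f = (X, Y, restrict f (elts X))"

lemma \<nu>_simps [simp]: "inv \<nu> (\<nu> i) = i" "\<nu> i = \<nu> j \<longleftrightarrow> i = j"
  using inj_\<nu> by (auto simp: inj_def)

lemma st [simp]: "st n \<in> U" "elts (st n) = \<nu> ` stn n"
  by (intro elem small_Pow(2)[OF small_range_\<nu>]; auto)+

lemma S_category [simp]: "is_category S"
  by (simp add: Sets_def fun_cat_category)

lemma Ob_S [simp]: "Ob S = U"
  by (simp add: Sets_def)

lemma Hom_S: "a \<in> Hom S X Y \<longleftrightarrow> X \<in> U \<and> Y \<in> U \<and> (\<exists>f\<in>elts X \<rightarrow>\<^sub>E elts Y. a = (X, Y, f))"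
  by (simp add: Sets_def Hom_fun_cat)

lemma arr_Hom: "X \<in> U \<Longrightarrow> Y \<in> U \<Longrightarrow> (\<And>x. x \<in> elts X \<Longrightarrow> f x \<in> elts Y) \<Longrightarrow> arr X Y f \<in> Hom S X Y"
  by (auto simp: Hom_S arr_def)

lemma app_arr [simp]: "x \<in> elts X \<Longrightarrow> app (arr X Y f) x = f x"
  by (simp add: app_def arr_def)

lemma app_mem: "a \<in> Hom S X Y \<Longrightarrow> x \<in> elts X \<Longrightarrow> app a x \<in> elts Y"
  by (auto simp: Hom_S app_def)

lemma app_Ident: "X \<in> U \<Longrightarrow> x \<in> elts X \<Longrightarrow> app (Ident S X) x = x"
  by (simp add: Sets_def app_def)

lemma app_Comp:
  "a \<in> Hom S X Y \<Longrightarrow> b \<in> Hom S Y Z \<Longrightarrow> x \<in> elts X \<Longrightarrow> app (Comp S a b) x = app b (app a x)"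
  by (auto simp: Hom_S app_def) (simp add: Sets_def)

lemma app_eqI:
  assumes "a \<in> Hom S X Y" "b \<in> Hom S X Y" "\<And>x. x \<in> elts X \<Longrightarrow> app a x = app b x"
  shows "a = b"
proof -
  obtain f g where "f \<in> elts X \<rightarrow>\<^sub>E elts Y" "a = (X, Y, f)" "g \<in> elts X \<rightarrow>\<^sub>E elts Y" "b = (X, Y, g)"
    using assms(1,2) unfolding Hom_S by blast
  then show ?thesis using assms(3) PiE_ext[of f "elts X" _ g] by (simp add: app_def)
qed

lemma J_simps:
  "FOb J n = st n"
  "f \<in> stn m \<rightarrow>\<^sub>E stn n \<Longrightarrow> FMor J (m, n, f) = arr (st m) (st n) (\<lambda>x. \<nu> (f (inv \<nu> x)))"
  by (simp_all add: Jf_def Let_def arr_def)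

lemma stn_PiE: "f \<in> stn m \<rightarrow>\<^sub>E stn n \<Longrightarrow> i < m \<Longrightarrow> f i < n"
  using PiE_mem[of f "stn m" "\<lambda>_. stn n" i] by simp

lemma J_functor: "is_functor FF S J"
  unfolding is_functor_def
proof (intro conjI ballI impI)
  show "FOb J \<in> Ob FF \<rightarrow>\<^sub>E Ob S" "FMor J \<in> extensional (Mor FF)"
    by (auto simp: J_simps(1)) (auto simp: Jf_def Let_def)
  show hom: "FMor J f \<in> Hom S (FOb J (Src FF f)) (FOb J (Tgt FF f))" if "f \<in> Mor FF" for f
    using that by (auto simp: J_simps stn_PiE intro!: arr_Hom)
  show "FMor J (Ident FF n) = Ident S (FOb J n)" for n
  proof (rule app_eqI)
    show "FMor J (Ident FF n) \<in> Hom S (st n) (st n)" "Ident S (FOb J n) \<in> Hom S (st n) (st n)"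
      using hom[of "Ident FF n"] by (auto simp: J_simps intro!: Ident_Hom)
  qed (auto simp: J_simps app_Ident)
  show "FMor J (Comp FF f g) = Comp S (FMor J f) (FMor J g)"
    if fg: "f \<in> Mor FF" "g \<in> Mor FF" "Tgt FF f = Src FF g" for f g
  proof -
    obtain k m n f' g' where [simp]: "f = (k, m, f')" "g = (m, n, g')"
      and f': "f' \<in> stn k \<rightarrow>\<^sub>E stn m" and g': "g' \<in> stn m \<rightarrow>\<^sub>E stn n" using fg by auto
    have c: "(\<lambda>x\<in>stn k. g' (f' x)) \<in> stn k \<rightarrow>\<^sub>E stn n" using f' g' by auto
    have f: "FMor J f \<in> Hom S (st k) (st m)" and g: "FMor J g \<in> Hom S (st m) (st n)"
      using hom[of f] hom[of g] f' g' by (auto simp: J_simps(1))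
    show ?thesis
    proof (rule app_eqI)
      show "FMor J (Comp FF f g) \<in> Hom S (st k) (st n)"
        using hom[of "Comp FF f g"] f' g' c by (auto simp: J_simps(1))
      show "Comp S (FMor J f) (FMor J g) \<in> Hom S (st k) (st n)"
        by (rule Comp_Hom[OF S_category f g])
      fix x assume "x \<in> elts (st k)"
      then obtain i where i: "i < k" "x = \<nu> i" by auto
      have "f' i < m" using f' i by auto
      moreover have "app (Comp S (FMor J f) (FMor J g)) x = app (FMor J g) (app (FMor J f) x)"
        by (rule app_Comp[OF f g]) (use i in auto)
      ultimately show "app (FMor J (Comp FF f g)) x = app (Comp S (FMor J f) (FMor J g)) x"
        using i f' g' c by (simp add: J_simps)
    qed
  qed
qed (simp_all add: FF_category)

lemma FMor_J_Hom: "b \<in> Hom FF m n \<Longrightarrow> FMor J b \<in> Hom S (st m) (st n)"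
  using functor_Hom[OF J_functor, of b m n] by (simp add: J_simps)

lemma app_J: "f \<in> stn m \<rightarrow>\<^sub>E stn n \<Longrightarrow> i < m \<Longrightarrow> app (FMor J (m, n, f)) (\<nu> i) = \<nu> (f i)"
  by (simp add: J_simps)

lemma app_J_point: "i < n \<Longrightarrow> app (FMor J (point n i)) (\<nu> 0) = \<nu> i"
  by (simp add: point_def app_J)

lemma app_J_ii:
  "i < m \<Longrightarrow> app (FMor J (ii0 m n)) (\<nu> i) = \<nu> i"
  "i < n \<Longrightarrow> app (FMor J (ii1 m n)) (\<nu> i) = \<nu> (m + i)"
  unfolding ii0_def ii1_def by (subst app_J; auto)+

section \<open>The Kleisli category as a Lawvere theory with a small copy\<close>

context
  fixes M :: "(nat, 'v, 'v \<times> 'v \<times> ('v \<Rightarrow> 'v)) rmon"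
  assumes M: "relative_monad FF S J M"
begin

lemma RR_U: "RR M n \<in> U"
  using relative_monad_RR[OF M, of n] by simp

lemma eta_Hom: "eta M n \<in> Hom S (st n) (RR M n)"
  using relative_monad_eta[OF M, of n] by (simp add: Hom_iff J_simps)

lemma rho_Hom: "f \<in> Hom S (st m) (RR M n) \<Longrightarrow> rho M m n f \<in> Hom S (RR M m) (RR M n)"
  and eta_rho: "f \<in> Hom S (st m) (RR M n) \<Longrightarrow> Comp S (eta M m) (rho M m n f) = f"
  using relative_monad_rho[OF M, of m n f] by (simp_all add: Hom_iff J_simps)

text \<open>Since \<open>eta\<close> followed by \<open>rho f\<close> is \<open>f\<close>, composing
  with a structure morphism in the Kleisli category is plain precomposition with \<open>J b\<close>
  in \<open>Sets\<close>. Questions about the structure functor thereby become questions about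
  functions on finite sets.\<close>

lemma kleisli_precomp:
  assumes b: "b \<in> Hom FF k m" and f: "f \<in> Hom S (st m) (RR M n)"
  shows "Comp (kleisli FF S J M) (FMor (kleisli_functor FF S J M) b) (m, n, f) = (k, n, Comp S (FMor J b) f)"
proof -
  have "Comp S (Comp S (FMor J b) (eta M m)) (rho M m n f) = Comp S (FMor J b) f"
    using FMor_J_Hom[OF b] eta_Hom[of m] rho_Hom[OF f] eta_rho[OF f] by (auto simp: Hom_iff)
  moreover have "Comp S (FMor J b) (eta M m) \<in> Hom S (st k) (RR M m)"
    by (rule Comp_Hom[OF S_category FMor_J_Hom[OF b] eta_Hom])
  ultimately show ?thesis
    using b f by (auto simp: Hom_iff[of b] J_simps simp del: FF_simps(2))
qed

lemma kleisli_Hom: "a \<in> Hom (kleisli FF S J M) m n \<longleftrightarrow> (\<exists>f \<in> Hom S (st m) (RR M n). a = (m, n, f))"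
  by (simp add: Hom_kleisli J_simps)

lemma kleisli_initial: "is_initial (kleisli FF S J M) 0"
  unfolding is_initial_def
proof (intro conjI ballI)
  fix n
  \<comment> \<open>\<open>st 0\<close> is empty, so \<open>\<lambda>x. x\<close> is an arbitrary
    choice for the only function out of it.\<close>
  have *: "arr (st 0) (RR M n) (\<lambda>x. x) \<in> Hom S (st 0) (RR M n)"
    by (rule arr_Hom) (auto simp: RR_U)
  show "\<exists>!f. f \<in> Hom (kleisli FF S J M) 0 n"
    by (rule ex1I[of _ "(0, n, arr (st 0) (RR M n) (\<lambda>x. x))"])
      (use * in \<open>auto simp: kleisli_Hom intro!: app_eqI[of _ "st 0" "RR M n"]\<close>)
qed simp

text \<open>By \<open>kleisli_precomp\<close> this says that a function on
  \<open>stn (m + n)\<close> is the same as a pair of functions on its initial and final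
  segments.\<close>

lemma kleisli_coproduct:
  "is_coproduct (kleisli FF S J M)
    (FMor (kleisli_functor FF S J M) (ii0 m n)) (FMor (kleisli_functor FF S J M) (ii1 m n))"
  unfolding is_coproduct_def
proof (intro ballI)
  let ?K = "kleisli FF S J M" and ?L = "kleisli_functor FF S J M"
  fix q u v
  have L: "FMor ?L (ii0 m n) \<in> Hom ?K m (m + n)" "FMor ?L (ii1 m n) \<in> Hom ?K n (m + n)"
    using functor_Hom[OF kleisli_functor[OF M] ii_Hom(1)] functor_Hom[OF kleisli_functor[OF M] ii_Hom(2)]
    by simp_all
  then have src_tgt: "Src ?K (FMor ?L (ii0 m n)) = m" "Src ?K (FMor ?L (ii1 m n)) = n"
      "Tgt ?K (FMor ?L (ii0 m n)) = m + n"
    by (auto simp only: Hom_iff)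
  assume "u \<in> Hom ?K (Src ?K (FMor ?L (ii0 m n))) q" "v \<in> Hom ?K (Src ?K (FMor ?L (ii1 m n))) q"
  then obtain f g where f: "f \<in> Hom S (st m) (RR M q)" "u = (m, q, f)"
    and g: "g \<in> Hom S (st n) (RR M q)" "v = (n, q, g)"
    unfolding src_tgt kleisli_Hom by blast
  \<comment> \<open>The two functions are glued along the cut at \<open>m\<close>; arguments are
    decoded by \<open>inv \<nu>\<close>, and in the final segment shifted down by
    \<open>m\<close>.\<close>
  define w where "w = arr (st (m + n)) (RR M q)
    (\<lambda>x. if inv \<nu> x < m then app f x else app g (\<nu> (inv \<nu> x - m)))"
  have w: "w \<in> Hom S (st (m + n)) (RR M q)"
    unfolding w_def by (rule arr_Hom) (use f g in \<open>auto simp: RR_U intro!: app_mem\<close>)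
  have J: "FMor J (ii0 m n) \<in> Hom S (st m) (st (m + n))" "FMor J (ii1 m n) \<in> Hom S (st n) (st (m + n))"
    using FMor_J_Hom ii_Hom by blast+
  have wfg: "Comp S (FMor J (ii0 m n)) w = f" "Comp S (FMor J (ii1 m n)) w = g"
  proof -
    have app_w: "app w (\<nu> i) = (if i < m then app f (\<nu> i) else app g (\<nu> (i - m)))" if "i < m + n" for i
      using that by (simp add: w_def)
    show "Comp S (FMor J (ii0 m n)) w = f"
      by (rule app_eqI[OF Comp_Hom[OF S_category J(1) w] f(1)])
        (auto simp: app_Comp[OF J(1) w] app_J_ii app_w)
    show "Comp S (FMor J (ii1 m n)) w = g"
      by (rule app_eqI[OF Comp_Hom[OF S_category J(2) w] g(1)])
        (auto simp: app_Comp[OF J(2) w] app_J_ii app_w)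
  qed
  show "\<exists>!w. w \<in> Hom ?K (Tgt ?K (FMor ?L (ii0 m n))) q \<and>
      Comp ?K (FMor ?L (ii0 m n)) w = u \<and> Comp ?K (FMor ?L (ii1 m n)) w = v"
    unfolding src_tgt
  proof (intro ex1I[of _ "(m + n, q, w)"] conjI)
    show "(m + n, q, w) \<in> Hom ?K (m + n) q" using w by (simp add: kleisli_Hom)
    show "Comp ?K (FMor ?L (ii0 m n)) (m + n, q, w) = u" "Comp ?K (FMor ?L (ii1 m n)) (m + n, q, w) = v"
      unfolding kleisli_precomp[OF ii_Hom(1) w] kleisli_precomp[OF ii_Hom(2) w] wfg f g by simp_all
    fix w' assume w': "w' \<in> Hom ?K (m + n) q \<and>
      Comp ?K (FMor ?L (ii0 m n)) w' = u \<and> Comp ?K (FMor ?L (ii1 m n)) w' = v"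
    then obtain h where h: "h \<in> Hom S (st (m + n)) (RR M q)" "w' = (m + n, q, h)"
      by (auto simp: kleisli_Hom)
    have eq: "Comp S (FMor J (ii0 m n)) h = f" "Comp S (FMor J (ii1 m n)) h = g"
      using w' unfolding h(2) kleisli_precomp[OF ii_Hom(1) h(1)] kleisli_precomp[OF ii_Hom(2) h(1)] f g
      by simp_all
    have "h = w"
    proof (rule app_eqI[OF h(1) w])
      fix x assume "x \<in> elts (st (m + n))"
      then obtain i where i: "i < m + n" "x = \<nu> i" by auto
      show "app h x = app w x"
      proof (cases "i < m")
        case True
        then show ?thesis
          using app_Comp[OF J(1) h(1), of x] app_Comp[OF J(1) w, of x] i by (simp add: app_J_ii eq wfg)
      next
        case False
        then show ?thesis
          using app_Comp[OF J(2) h(1), of "\<nu> (i - m)"] app_Comp[OF J(2) w, of "\<nu> (i - m)"] i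
          by (simp add: app_J_ii eq wfg)
      qed
    qed
    then show "w' = (m + n, q, w)" by (simp add: h(2))
  qed
qed

lemma kleisli_lawvere_theory: "lawvere_theory (kleisli FF S J M) (kleisli_functor FF S J M)"
proof -
  have "FOb (kleisli_functor FF S J M) = id" by (auto simp: fun_eq_iff)
  then show ?thesis
    unfolding lawvere_theory_iff
    using kleisli_functor[OF M] kleisli_initial kleisli_coproduct by simp
qed

text \<open>A morphism also stores the sets \<open>st m\<close> and \<open>RR M n\<close>, but these
  are determined by \<open>m\<close> and \<open>n\<close>. It suffices to encode the two numbers and
  the underlying function, which lie in a dependent sum of function sets.\<close>

lemma kleisli_essentially_small: "essentially_small (Mor (kleisli FF S J M))"
proof (rule essentially_small_inj)
  have nat: "essentially_small (UNIV :: nat set)"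
    unfolding essentially_small_def using inj_\<nu> small_range_\<nu> by blast
  have "essentially_small (elts (st m) \<rightarrow>\<^sub>E elts (RR M n))" for m n
    by (intro essentially_small_PiE essentially_small_small small_elts RR_U) simp
  then show "essentially_small (SIGMA m:UNIV. SIGMA n:UNIV. elts (st m) \<rightarrow>\<^sub>E elts (RR M n))"
    by (intro essentially_small_Sigma nat)
  show "inj_on (\<lambda>(m, n, f). (m, n, app f)) (Mor (kleisli FF S J M))"
    by (auto simp: inj_on_def J_simps app_def Hom_S)
qed (auto simp: J_simps app_def Hom_S)

text \<open>Objects are encoded by \<open>\<nu>\<close>, so the copy has the small set
  \<open>range \<nu>\<close> as objects; any encoding of the morphisms with small image will
  do.\<close>

lemma kleisli_small_copy:
  "\<exists>T \<Phi>. iso_functor (kleisli FF S J M) T \<Phi> \<and> small (Ob T) \<and> small (Mor T)"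
proof -
  obtain e where e: "inj_on e (Mor (kleisli FF S J M))" "small (e ` Mor (kleisli FF S J M))"
    using kleisli_essentially_small by (auto simp: essentially_small_def)
  have "inj_on \<nu> (Ob (kleisli FF S J M))" using inj_\<nu> by simp
  from iso_functor_transport[OF kleisli_category[OF M] this e(1)] show ?thesis
    using e(2) small_range_\<nu> by auto
qed

end

section \<open>Full faithfulness for functors between Kleisli categories\<close>

abbreviation const :: "'v \<Rightarrow> 'v \<Rightarrow> 'v \<times> 'v \<times> ('v \<Rightarrow> 'v)" where
  "const X x \<equiv> arr (st 1) X (\<lambda>_. x)"

lemma const_Hom: "X \<in> U \<Longrightarrow> x \<in> elts X \<Longrightarrow> const X x \<in> Hom S (st 1) X"
  by (auto intro!: arr_Hom)

text \<open>Restriction along the \<open>i\<close>-th point is evaluation at \<open>\<nu> i\<close>.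
  This translates between elements and Kleisli morphisms out of \<open>1\<close>.\<close>

lemma const_point:
  assumes f: "f \<in> Hom S (st m) X" and i: "i < m"
  shows "Comp S (FMor J (point m i)) f = const X (app f (\<nu> i))"
proof -
  note p = FMor_J_Hom[OF point_Hom[OF i]]
  have X: "X \<in> U" using f by (auto simp: Hom_S)
  show ?thesis
    by (rule app_eqI[OF Comp_Hom[OF S_category p f] const_Hom[OF X]])
      (use i in \<open>auto simp: app_Comp[OF p f] app_J_point intro!: app_mem[OF f]\<close>)
qed

context
  fixes M M' :: "(nat, 'v, 'v \<times> 'v \<times> ('v \<Rightarrow> 'v)) rmon"
  assumes M: "relative_monad FF S J M" and M': "relative_monad FF S J M'"
begin

lemma rmon_morphism_Hom: "rmon_morphism FF S J M M' \<phi> \<Longrightarrow> \<phi> n \<in> Hom S (RR M n) (RR M' n)"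
  using rmon_morphism_Mor[of FF S J M M' \<phi> n] by (simp add: Hom_iff)

text \<open>The functor sends \<open>const x\<close>, as a morphism
  \<open>1 \<rightarrow> n\<close>, to \<open>const x\<close> followed by \<open>\<phi> n\<close>,
  whose value at \<open>\<nu> 0\<close> is the value of \<open>\<phi> n\<close> at
  \<open>x\<close>.\<close>

lemma kleisli_map_faithful:
  assumes \<phi>: "rmon_morphism FF S J M M' \<phi>" and \<psi>: "rmon_morphism FF S J M M' \<psi>"
    and eq: "kleisli_map FF S J M \<phi> = kleisli_map FF S J M \<psi>"
  shows "\<phi> = \<psi>"
proof
  fix n
  note p = rmon_morphism_Hom[OF \<phi>, of n] rmon_morphism_Hom[OF \<psi>, of n]
  show "\<phi> n = \<psi> n"
  proof (rule app_eqI[OF p])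
    fix x assume x: "x \<in> elts (RR M n)"
    note c = const_Hom[OF RR_U[OF M] x]
    have "Comp S (const (RR M n) x) (\<phi> n) = Comp S (const (RR M n) x) (\<psi> n)"
      using arg_cong[OF eq, of "\<lambda>G. FMor G (1, n, const (RR M n) x)"] c by (simp add: J_simps)
    then show "app (\<phi> n) x = app (\<psi> n) x"
      using app_Comp[OF c p(1), of "\<nu> 0"] app_Comp[OF c p(2), of "\<nu> 0"] by simp
  qed
qed

text \<open>An element of \<open>RR M n\<close> is a Kleisli morphism from \<open>1\<close> to \<open>n\<close>, and a functor under \<open>FF\<close> acts
  on Kleisli morphisms from \<open>m\<close> to \<open>n\<close> through their restrictions to the \<open>m\<close> points.\<close>

lemma kleisli_map_full:
  assumes G: "is_functor (kleisli FF S J M) (kleisli FF S J M') G"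
    and under: "functor_comp FF (kleisli_functor FF S J M) G = kleisli_functor FF S J M'"
  shows "\<exists>\<phi>. rmon_morphism FF S J M M' \<phi> \<and> kleisli_map FF S J M \<phi> = G"
proof -
  let ?K = "kleisli FF S J M" and ?L = "kleisli_functor FF S J M"
    and ?K' = "kleisli FF S J M'" and ?L' = "kleisli_functor FF S J M'"
  have GO: "FOb G n = n" for n
    using arg_cong[OF under, of "\<lambda>F. FOb F n"] by simp
  have GL: "FMor G (FMor ?L b) = FMor ?L' b" if "b \<in> Hom FF m n" for b m n
    using arg_cong[OF under, of "\<lambda>F. FMor F b"] that by (simp add: Hom_iff del: FF_simps(2) kleisli_functor_simps)
  define g where "g m n f = snd (snd (FMor G (m, n, f)))" for m n f
  have g: "g m n f \<in> Hom S (st m) (RR M' n) \<and> FMor G (m, n, f) = (m, n, g m n f)"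
    if "f \<in> Hom S (st m) (RR M n)" for m n f
    using functor_Hom[OF G, of "(m, n, f)" m n] that unfolding GO g_def
    by (auto simp: kleisli_Hom[OF M] kleisli_Hom[OF M'])
  note gH = g[THEN conjunct1] and Gg = g[THEN conjunct2]
  \<comment> \<open>The hypothesis \<open>under\<close> is used here: precomposition with
    \<open>J b\<close> is Kleisli composition with the image of \<open>b\<close>, which
    \<open>G\<close> sends to the corresponding image for \<open>M'\<close>.\<close>
  have precomp: "g k n (Comp S (FMor J b) f) = Comp S (FMor J b) (g m n f)"
    if b: "b \<in> Hom FF k m" and f: "f \<in> Hom S (st m) (RR M n)" for b k m n f
  proof -
    have "(k, n, g k n (Comp S (FMor J b) f)) = FMor G (Comp ?K (FMor ?L b) (m, n, f))"
      unfolding kleisli_precomp[OF M b f] by (rule Gg[symmetric]) (rule Comp_Hom[OF S_category FMor_J_Hom[OF b] f])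
    also have "\<dots> = Comp ?K' (FMor ?L' b) (m, n, g m n f)"
      using functor_Comp_Hom[OF G, of "FMor ?L b" k m "(m, n, f)" n] functor_Hom[OF kleisli_functor[OF M] b] f
      by (simp add: GL[OF b] Gg[OF f] kleisli_Hom[OF M] del: kleisli_functor_simps(2))
    also have "\<dots> = (k, n, Comp S (FMor J b) (g m n f))"
      by (rule kleisli_precomp[OF M' b gH[OF f]])
    finally show ?thesis by simp
  qed
  \<comment> \<open>\<open>x\<close> is regarded as a morphism \<open>1 \<rightarrow> n\<close>,
    \<open>G\<close> is applied, and the result is read at \<open>\<nu> 0\<close>, the only element
    of \<open>st 1\<close>.\<close>
  define \<phi> where "\<phi> n = arr (RR M n) (RR M' n) (\<lambda>x. app (g 1 n (const (RR M n) x)) (\<nu> 0))" for n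
  have \<phi>: "\<phi> n \<in> Hom S (RR M n) (RR M' n)" for n
    unfolding \<phi>_def
    by (rule arr_Hom[OF RR_U[OF M] RR_U[OF M']], rule app_mem[OF gH[OF const_Hom[OF RR_U[OF M]]]]) auto
  have app_\<phi>: "app (\<phi> n) x = app (g 1 n (const (RR M n) x)) (\<nu> 0)" if "x \<in> elts (RR M n)" for n x
    using that by (simp add: \<phi>_def)
  \<comment> \<open>By \<open>precomp\<close>, restricting along the \<open>i\<close>-th point
    reduces \<open>g m n\<close> to \<open>g 1 n\<close>, from which \<open>\<phi>\<close> was
    defined.\<close>
  have g\<phi>: "g m n f = Comp S f (\<phi> n)" if f: "f \<in> Hom S (st m) (RR M n)" for m n f
  proof (rule app_eqI[OF gH[OF f] Comp_Hom[OF S_category f \<phi>]])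
    fix x assume "x \<in> elts (st m)"
    then obtain i where i: "i < m" "x = \<nu> i" by auto
    note p = point_Hom[OF i(1)]
    have "app (Comp S f (\<phi> n)) x = app (g 1 n (Comp S (FMor J (point m i)) f)) (\<nu> 0)"
      using i app_mem[OF f, of "\<nu> i"] by (simp add: app_Comp[OF f \<phi>] const_point[OF f] app_\<phi>)
    also have "\<dots> = app (g m n f) x"
      unfolding precomp[OF p f] using i
      by (subst app_Comp[OF FMor_J_Hom[OF p] gH[OF f]]) (auto simp: app_J_point)
    finally show "app (g m n f) x = app (Comp S f (\<phi> n)) x" by simp
  qed
  have "rmon_morphism FF S J M M' \<phi>"
    unfolding rmon_morphism_def
  proof (intro conjI ballI)
    \<comment> \<open>\<open>eta M n\<close> is the Kleisli identity of \<open>n\<close>, so this is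
      preservation of identities by \<open>G\<close>.\<close>
    show "eta M' n = Comp S (eta M n) (\<phi> n)" for n
      using functor_Ident[OF G, of n] Gg[OF eta_Hom[OF M, of n]] g\<phi>[OF eta_Hom[OF M, of n]] by (simp add: GO)
    fix m n f assume "f \<in> Hom S (FOb J m) (RR M n)"
    then have f: "f \<in> Hom S (st m) (RR M n)" by (simp add: J_simps)
    have f\<phi>: "Comp S f (\<phi> n) \<in> Hom S (st m) (RR M' n)"
      by (rule Comp_Hom[OF S_category f \<phi>])
    note r = rho_Hom[OF M f] and r' = rho_Hom[OF M' f\<phi>]
    show "Comp S (rho M m n f) (\<phi> n) = Comp S (\<phi> m) (rho M' m n (Comp S f (\<phi> n)))"
    proof (rule app_eqI[OF Comp_Hom[OF S_category r \<phi>] Comp_Hom[OF S_category \<phi> r']])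
      fix x assume x: "x \<in> elts (RR M m)"
      \<comment> \<open>After precomposition with \<open>?c\<close> the equation becomes
        preservation by \<open>G\<close> of the Kleisli composite
        \<open>1 \<rightarrow> m \<rightarrow> n\<close>; evaluation at \<open>\<nu> 0\<close> then
        returns the statement at \<open>x\<close>.\<close>
      let ?c = "const (RR M m) x"
      have c: "?c \<in> Hom S (st 1) (RR M m)" by (rule const_Hom[OF RR_U[OF M] x])
      have c\<phi>: "Comp S ?c (\<phi> m) \<in> Hom S (st 1) (RR M' m)" by (rule Comp_Hom[OF S_category c \<phi>])
      have cr: "Comp S ?c (rho M m n f) \<in> Hom S (st 1) (RR M n)" by (rule Comp_Hom[OF S_category c r])
      have "FMor G (Comp ?K (1, m, ?c) (m, n, f)) = Comp ?K' (FMor G (1, m, ?c)) (FMor G (m, n, f))"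
        by (rule functor_Comp_Hom[OF G]) (use c f in \<open>auto simp: kleisli_Hom[OF M]\<close>)
      then have "Comp S (Comp S ?c (rho M m n f)) (\<phi> n)
          = Comp S (Comp S ?c (\<phi> m)) (rho M' m n (Comp S f (\<phi> n)))"
        using c f c\<phi> f\<phi> cr by (simp add: J_simps Gg g\<phi>)
      from arg_cong[OF this, of "\<lambda>a. app a (\<nu> 0)"]
      show "app (Comp S (rho M m n f) (\<phi> n)) x
          = app (Comp S (\<phi> m) (rho M' m n (Comp S f (\<phi> n)))) x"
        using x by (simp add: app_Comp[OF cr \<phi>] app_Comp[OF c\<phi> r'] app_Comp[OF c r] app_Comp[OF c \<phi>]
          app_Comp[OF r \<phi>] app_Comp[OF \<phi> r'] del: One_nat_def)
    qed
  qed (auto simp: \<phi>)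
  moreover from this have "kleisli_map FF S J M \<phi> = G"
    by (intro functor_eqI[OF kleisli_map_functor[OF M M'] G])
      (auto simp: GO Gg g\<phi> J_simps)
  ultimately show ?thesis by blast
qed

end

end


section \<open>The relative monad of a Lawvere theory\<close>

text \<open>In a Lawvere theory \<open>L m\<close> is the \<open>m\<close>-th copower of \<open>L 1\<close>, because \<open>m + 1\<close> is the coproduct of
  \<open>m\<close> and \<open>1\<close>.\<close>

lemma lawvere_copower:
  assumes T: "lawvere_theory T L" and Q: "Q \<in> Ob T"
  shows "(\<And>i. i < m \<Longrightarrow> u i \<in> Hom T (FOb L 1) Q) \<Longrightarrow>
    \<exists>!w. w \<in> Hom T (FOb L m) Q \<and> (\<forall>i<m. Comp T (FMor L (point m i)) w = u i)"
proof (induction m)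
  \<comment> \<open>No component is prescribed, so this is initiality of \<open>L 0\<close>.\<close>
  case 0
  then show ?case using T Q by (auto simp: lawvere_theory_iff is_initial_def)
next
  case (Suc m)
  \<comment> \<open>The final segment of length \<open>1\<close> in \<open>m + 1\<close> is the
    point \<open>m\<close>, so the coproduct adds exactly one component.\<close>
  have L: "is_functor FF T L" and co: "is_coproduct T (FMor L (ii0 m 1)) (FMor L (point (m + 1) m))"
    unfolding ii1_point[symmetric] using T unfolding lawvere_theory_iff by blast+
  have h: "FMor L (ii0 m 1) \<in> Hom T (FOb L m) (FOb L (m + 1))"
    and k: "FMor L (point (m + 1) m) \<in> Hom T (FOb L 1) (FOb L (m + 1))"
    using functor_Hom[OF L ii_Hom(1)[of m 1]] functor_Hom[OF L point_Hom[of m "m + 1"]] by simp_all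
  have p: "FMor L (point m i) \<in> Hom T (FOb L 1) (FOb L m)" if "i < m" for i
    using functor_Hom[OF L point_Hom[OF that]] .
  have restr: "Comp T (FMor L (point (m + 1) i)) w = Comp T (FMor L (point m i)) (Comp T (FMor L (ii0 m 1)) w)"
    if i: "i < m" and w: "w \<in> Hom T (FOb L (m + 1)) Q" for i w
  proof -
    have "FMor L (point (m + 1) i) = Comp T (FMor L (point m i)) (FMor L (ii0 m 1))"
      using functor_Comp_Hom[OF L point_Hom[OF i] ii_Hom(1)[of m 1]] by (simp only: point_ii(1)[OF i])
    then show ?thesis
      using functor_cat(2)[OF L] p[OF i] h w by (auto simp: Hom_iff simp del: One_nat_def)
  qed
  \<comment> \<open>\<open>w\<close> has the first \<open>m\<close> components by induction;
    \<open>v\<close> below joins it with the last component \<open>u m\<close>.\<close>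
  obtain w where w: "w \<in> Hom T (FOb L m) Q" "\<And>i. i < m \<Longrightarrow> Comp T (FMor L (point m i)) w = u i"
    and w_uniq: "\<And>w'. w' \<in> Hom T (FOb L m) Q \<Longrightarrow>
      (\<And>i. i < m \<Longrightarrow> Comp T (FMor L (point m i)) w' = u i) \<Longrightarrow> w' = w"
    using Suc.IH[OF Suc.prems] by (auto simp: less_Suc_eq)
  have "u m \<in> Hom T (FOb L 1) Q" using Suc.prems by simp
  then have "\<exists>!v. v \<in> Hom T (FOb L (m + 1)) Q \<and> Comp T (FMor L (ii0 m 1)) v = w \<and>
      Comp T (FMor L (point (m + 1) m)) v = u m"
    using co h k w(1) Q unfolding is_coproduct_def Hom_iff[of "FMor L _"] by metis
  then obtain v where v: "v \<in> Hom T (FOb L (m + 1)) Q" "Comp T (FMor L (ii0 m 1)) v = w"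
      "Comp T (FMor L (point (m + 1) m)) v = u m"
    and v_uniq: "\<And>v'. v' \<in> Hom T (FOb L (m + 1)) Q \<Longrightarrow> Comp T (FMor L (ii0 m 1)) v' = w \<Longrightarrow>
      Comp T (FMor L (point (m + 1) m)) v' = u m \<Longrightarrow> v' = v"
    by blast
  show ?case
    unfolding Suc_eq_plus1
  proof (intro ex1I[of _ v] conjI allI impI)
    show "Comp T (FMor L (point (m + 1) i)) v = u i" if "i < m + 1" for i
      using restr[OF _ v(1), of i] v w(2)[of i] that by (cases "i = m") (simp_all del: One_nat_def)
    fix v' assume v': "v' \<in> Hom T (FOb L (m + 1)) Q \<and> (\<forall>i<m + 1. Comp T (FMor L (point (m + 1) i)) v' = u i)"
    show "v' = v"
    proof (rule v_uniq)
      \<comment> \<open>The restriction of \<open>v'\<close> to \<open>L m\<close> has the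
        components of \<open>w\<close>, so the uniqueness part of the induction hypothesis
        applies.\<close>
      show "Comp T (FMor L (ii0 m 1)) v' = w"
      proof (rule w_uniq)
        show "Comp T (FMor L (ii0 m 1)) v' \<in> Hom T (FOb L m) Q"
          by (rule Comp_Hom[OF functor_cat(2)[OF L] h]) (use v' in blast)
        show "Comp T (FMor L (point m i)) (Comp T (FMor L (ii0 m 1)) v') = u i" if "i < m" for i
          using restr[OF that, of v'] v' that by (simp del: One_nat_def)
      qed
    qed (use v' in auto)
  qed (rule v(1))
qed

context universe_nat
begin

context
  fixes T :: "('v, 'v) cat" and L
  assumes T: "lawvere_theory T L" and small_T: "small (Mor T)"
begin

lemma L_functor: "is_functor FF T L"
  using T by (simp add: lawvere_theory_iff)

lemma T_category: "is_category T"
  using functor_cat(2)[OF L_functor] .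

lemma L_Ob: "FOb L n \<in> Ob T"
  using functor_Ob[OF L_functor, of n] by simp

lemma L_point: "i < m \<Longrightarrow> FMor L (point m i) \<in> Hom T (FOb L 1) (FOb L m)"
  using functor_Hom[OF L_functor point_Hom] .

text \<open>Morphisms of \<open>T\<close> are elements of the universe and the hom-set is a subset
  of the small set \<open>Mor T\<close>, so it can serve as an object of \<open>Sets\<close> without
  encoding.\<close>

definition hom_obj :: "nat \<Rightarrow> 'v" where "hom_obj n = elem (Hom T (FOb L 1) (FOb L n))"

lemma hom_obj: "hom_obj n \<in> U" "elts (hom_obj n) = Hom T (FOb L 1) (FOb L n)"
  unfolding hom_obj_def by (intro elem small_Pow(2)[OF small_T]; auto simp: Hom_def)+

text \<open>The copairing \<open>[f 0, ..., f (m - 1)]\<close> of a family of morphisms from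
  \<open>L 1\<close> to \<open>L n\<close>, the family being given as a function on
  \<open>st m\<close>.\<close>

definition copair :: "nat \<Rightarrow> nat \<Rightarrow> 'v \<times> 'v \<times> ('v \<Rightarrow> 'v) \<Rightarrow> 'v" where
  "copair m n f = (THE w. w \<in> Hom T (FOb L m) (FOb L n) \<and>
     (\<forall>i<m. Comp T (FMor L (point m i)) w = app f (\<nu> i)))"

lemma copair_ex1:
  assumes "f \<in> Hom S (st m) (hom_obj n)"
  shows "\<exists>!w. w \<in> Hom T (FOb L m) (FOb L n) \<and> (\<forall>i<m. Comp T (FMor L (point m i)) w = app f (\<nu> i))"
  by (rule lawvere_copower[OF T L_Ob]) (use app_mem[OF assms] in \<open>simp add: hom_obj\<close>)

lemma copair:
  assumes "f \<in> Hom S (st m) (hom_obj n)"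
  shows "copair m n f \<in> Hom T (FOb L m) (FOb L n)"
    and "i < m \<Longrightarrow> Comp T (FMor L (point m i)) (copair m n f) = app f (\<nu> i)"
  using theI'[OF copair_ex1[OF assms]] unfolding copair_def by auto

lemma copair_eqI:
  assumes "f \<in> Hom S (st m) (hom_obj n)" "w \<in> Hom T (FOb L m) (FOb L n)"
    "\<And>i. i < m \<Longrightarrow> Comp T (FMor L (point m i)) w = app f (\<nu> i)"
  shows "copair m n f = w"
  using copair_ex1[OF assms(1)] copair[OF assms(1)] assms(2,3) by blast

text \<open>\<open>eta\<close> lists the copower injections, and \<open>rho\<close> acts by
  composition with a copairing. The guard in \<open>rho\<close> supplies the value
  \<open>undefined\<close> that \<open>relative_monad\<close> demands outside the domain.\<close>

definition theory_monad :: "(nat, 'v, 'v \<times> 'v \<times> ('v \<Rightarrow> 'v)) rmon" where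
  "theory_monad = \<lparr>RR = hom_obj,
     eta = (\<lambda>n. arr (st n) (hom_obj n) (\<lambda>x. FMor L (point n (inv \<nu> x)))),
     rho = (\<lambda>m n f. if f \<in> Hom S (st m) (hom_obj n)
       then arr (hom_obj m) (hom_obj n) (\<lambda>x. Comp T x (copair m n f)) else undefined)\<rparr>"

lemma RR_theory_monad [simp]: "RR theory_monad = hom_obj"
  by (simp add: theory_monad_def)

lemma eta_theory_monad:
  "eta theory_monad n \<in> Hom S (st n) (hom_obj n)"
  "i < n \<Longrightarrow> app (eta theory_monad n) (\<nu> i) = FMor L (point n i)"
  by (auto simp: theory_monad_def hom_obj intro!: arr_Hom L_point simp del: One_nat_def)

lemma rho_theory_monad:
  assumes f: "f \<in> Hom S (st m) (hom_obj n)"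
  shows "rho theory_monad m n f \<in> Hom S (hom_obj m) (hom_obj n)"
    and "x \<in> Hom T (FOb L 1) (FOb L m) \<Longrightarrow> app (rho theory_monad m n f) x = Comp T x (copair m n f)"
  using f by (auto simp: theory_monad_def hom_obj intro!: arr_Hom Comp_Hom[OF T_category] copair)

text \<open>If \<open>b\<close> carries the function \<open>g\<close>, both sides have the
  \<open>i\<close>-th component \<open>L (point n (g i))\<close>. This makes the comparison with
  \<open>T\<close> strictly compatible with \<open>L\<close>.\<close>

lemma copair_J_eta:
  assumes b: "b \<in> Hom FF m n"
  shows "copair m n (Comp S (FMor J b) (eta theory_monad n)) = FMor L b"
proof (rule copair_eqI)
  note Jb = FMor_J_Hom[OF b] and e = eta_theory_monad(1)[of n]
  show "Comp S (FMor J b) (eta theory_monad n) \<in> Hom S (st m) (hom_obj n)"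
    by (rule Comp_Hom[OF S_category Jb e])
  show "FMor L b \<in> Hom T (FOb L m) (FOb L n)" by (rule functor_Hom[OF L_functor b])
  fix i assume i: "i < m"
  obtain g where g: "b = (m, n, g)" "g \<in> stn m \<rightarrow>\<^sub>E stn n" using b by (auto simp: Hom_FF)
  have "Comp T (FMor L (point m i)) (FMor L b) = FMor L (point n (g i))"
    using functor_Comp_Hom[OF L_functor point_Hom[OF i] b] point_Comp[OF i g(2)] g by simp
  also have "\<dots> = app (eta theory_monad n) (app (FMor J b) (\<nu> i))"
    using g i by (simp add: app_J eta_theory_monad stn_PiE)
  finally show "Comp T (FMor L (point m i)) (FMor L b) = app (Comp S (FMor J b) (eta theory_monad n)) (\<nu> i)"
    using i by (simp add: app_Comp[OF Jb e])
qed

lemma copair_eta: "copair n n (eta theory_monad n) = Ident T (FOb L n)"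
proof (rule copair_eqI[OF eta_theory_monad(1)])
  show "Ident T (FOb L n) \<in> Hom T (FOb L n) (FOb L n)" by (rule Ident_Hom[OF T_category L_Ob])
  show "Comp T (FMor L (point n i)) (Ident T (FOb L n)) = app (eta theory_monad n) (\<nu> i)" if "i < n" for i
    using L_point[OF that] that T_category by (simp add: eta_theory_monad Hom_iff)
qed

text \<open>The components agree by associativity in \<open>T\<close>. Both the composition axiom of
  \<open>theory_monad\<close> and functoriality of \<open>kleisli_theory_iso\<close> come from
  this.\<close>

lemma copair_rho:
  assumes f: "f \<in> Hom S (st k) (hom_obj m)" and g: "g \<in> Hom S (st m) (hom_obj n)"
  shows "copair k n (Comp S f (rho theory_monad m n g)) = Comp T (copair k m f) (copair m n g)"
proof (rule copair_eqI)
  note r = rho_theory_monad(1)[OF g]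
  show "Comp S f (rho theory_monad m n g) \<in> Hom S (st k) (hom_obj n)"
    by (rule Comp_Hom[OF S_category f r])
  show "Comp T (copair k m f) (copair m n g) \<in> Hom T (FOb L k) (FOb L n)"
    by (rule Comp_Hom[OF T_category copair(1)[OF f] copair(1)[OF g]])
  fix i assume i: "i < k"
  have "Comp T (FMor L (point k i)) (Comp T (copair k m f) (copair m n g))
      = Comp T (Comp T (FMor L (point k i)) (copair k m f)) (copair m n g)"
    using L_point[OF i] copair(1)[OF f] copair(1)[OF g] T_category by (simp add: Hom_iff)
  also have "\<dots> = app (Comp S f (rho theory_monad m n g)) (\<nu> i)"
    using i app_mem[OF f, of "\<nu> i"]
    by (simp add: copair(2)[OF f] app_Comp[OF f r] rho_theory_monad(2)[OF g] hom_obj)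
  finally show "Comp T (FMor L (point k i)) (Comp T (copair k m f) (copair m n g))
      = app (Comp S f (rho theory_monad m n g)) (\<nu> i)" .
qed

lemma relative_monad_theory_monad: "relative_monad FF S J theory_monad"
  unfolding relative_monad_def RR_theory_monad J_simps(1)
proof (intro conjI ballI allI impI)
  show "rho theory_monad X Y f = undefined"
    if "\<not> (X \<in> Ob FF \<and> Y \<in> Ob FF \<and> f \<in> Hom S (st X) (hom_obj Y))" for X Y f
    using that by (auto simp: theory_monad_def)
  show "rho theory_monad n n (eta theory_monad n) = Ident S (hom_obj n)" for n
    by (rule app_eqI[OF rho_theory_monad(1)[OF eta_theory_monad(1)] Ident_Hom])
      (auto simp: hom_obj app_Ident rho_theory_monad(2)[OF eta_theory_monad(1)] copair_eta Hom_iff T_category)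
  show "Comp S (eta theory_monad m) (rho theory_monad m n f) = f" if f: "f \<in> Hom S (st m) (hom_obj n)" for m n f
    by (rule app_eqI[OF Comp_Hom[OF S_category eta_theory_monad(1) rho_theory_monad(1)[OF f]] f])
      (auto simp: app_Comp[OF eta_theory_monad(1) rho_theory_monad(1)[OF f]] eta_theory_monad(2)
        rho_theory_monad(2)[OF f] L_point copair(2)[OF f] simp del: One_nat_def)
  show "Comp S (rho theory_monad k m f) (rho theory_monad m n g)
      = rho theory_monad k n (Comp S f (rho theory_monad m n g))"
    if f: "f \<in> Hom S (st k) (hom_obj m)" and g: "g \<in> Hom S (st m) (hom_obj n)" for k m n f g
  proof -
    note rf = rho_theory_monad(1)[OF f] and rg = rho_theory_monad(1)[OF g]
    note fg = Comp_Hom[OF S_category f rg]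
    show ?thesis
    proof (rule app_eqI[OF Comp_Hom[OF S_category rf rg] rho_theory_monad(1)[OF fg]])
      fix x assume "x \<in> elts (hom_obj k)"
      then have x: "x \<in> elts (hom_obj k)" "x \<in> Hom T (FOb L 1) (FOb L k)" by (simp_all add: hom_obj)
      have "Comp T x (copair k m f) \<in> Hom T (FOb L 1) (FOb L m)"
        by (rule Comp_Hom[OF T_category x(2) copair(1)[OF f]])
      then have "app (Comp S (rho theory_monad k m f) (rho theory_monad m n g)) x
          = Comp T (Comp T x (copair k m f)) (copair m n g)"
        using x by (simp add: app_Comp[OF rf rg] rho_theory_monad(2)[OF f] rho_theory_monad(2)[OF g] del: One_nat_def)
      also have "\<dots> = app (rho theory_monad k n (Comp S f (rho theory_monad m n g))) x"
        using x(2) copair(1)[OF f] copair(1)[OF g] T_category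
        by (simp add: rho_theory_monad(2)[OF fg] copair_rho[OF f g]) (simp add: Hom_iff)
      finally show "app (Comp S (rho theory_monad k m f) (rho theory_monad m n g)) x
          = app (rho theory_monad k n (Comp S f (rho theory_monad m n g))) x" .
    qed
  qed
qed (auto simp: J_functor hom_obj eta_theory_monad rho_theory_monad)

definition kleisli_theory_iso :: "(nat, nat \<times> nat \<times> 'v \<times> 'v \<times> ('v \<Rightarrow> 'v), 'v, 'v) fnct" where
  "kleisli_theory_iso = \<lparr>FOb = FOb L,
     FMor = (\<lambda>(m, n, f)\<in>Mor (kleisli FF S J theory_monad). copair m n f)\<rparr>"

lemma kleisli_theory_iso_simps:
  "FOb kleisli_theory_iso = FOb L"
  "f \<in> Hom S (st m) (hom_obj n) \<Longrightarrow> FMor kleisli_theory_iso (m, n, f) = copair m n f"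
  by (simp_all add: kleisli_theory_iso_def J_simps)

text \<open>By the copower property a morphism from \<open>L m\<close> to \<open>L n\<close> and its
  family of \<open>m\<close> components determine each other, and \<open>L\<close> matches the
  numbers with the objects of \<open>T\<close>.\<close>

lemma iso_functor_kleisli_theory_iso: "iso_functor (kleisli FF S J theory_monad) T kleisli_theory_iso"
proof -
  let ?K = "kleisli FF S J theory_monad"
  note simps = kleisli_theory_iso_simps
  have Lbij: "bij_betw (FOb L) UNIV (Ob T)" using T by (simp add: lawvere_theory_iff)
  have MorK: "a \<in> Mor ?K \<longleftrightarrow> (\<exists>m n f. a = (m, n, f) \<and> f \<in> Hom S (st m) (hom_obj n))" for a
    by (cases a) (simp add: J_simps)
  have "is_functor ?K T kleisli_theory_iso"
    unfolding is_functor_def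
  proof (intro conjI ballI impI)
    show "is_category ?K" by (rule kleisli_category[OF relative_monad_theory_monad])
    show "FMor kleisli_theory_iso \<in> extensional (Mor ?K)"
      unfolding kleisli_theory_iso_def fnct.simps by (rule restrict_extensional)
    show "FMor kleisli_theory_iso a \<in> Hom T (FOb kleisli_theory_iso (Src ?K a)) (FOb kleisli_theory_iso (Tgt ?K a))"
      if "a \<in> Mor ?K" for a
      using that unfolding MorK by (auto simp: simps J_simps intro!: copair)
    show "FMor kleisli_theory_iso (Comp ?K a b) = Comp T (FMor kleisli_theory_iso a) (FMor kleisli_theory_iso b)"
      if prems: "a \<in> Mor ?K" "b \<in> Mor ?K" "Tgt ?K a = Src ?K b" for a b
    proof -
      obtain k m n f g where ab: "a = (k, m, f)" "b = (m, n, g)"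
        and f: "f \<in> Hom S (st k) (hom_obj m)" and g: "g \<in> Hom S (st m) (hom_obj n)"
        using prems unfolding MorK by (auto simp: J_simps)
      show ?thesis
        using f g Comp_Hom[OF S_category f rho_theory_monad(1)[OF g]]
        by (simp add: ab J_simps simps copair_rho)
    qed
  qed (auto simp: simps L_Ob T_category copair_eta eta_theory_monad)
  moreover have "inj_on (FMor kleisli_theory_iso) (Mor ?K)"
  proof (rule inj_onI)
    fix a b assume "a \<in> Mor ?K" "b \<in> Mor ?K" and eq: "FMor kleisli_theory_iso a = FMor kleisli_theory_iso b"
    then obtain m n f m' n' g where ab: "a = (m, n, f)" "b = (m', n', g)"
      and f: "f \<in> Hom S (st m) (hom_obj n)" and g: "g \<in> Hom S (st m') (hom_obj n')"
      unfolding MorK by blast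
    have eq: "copair m n f = copair m' n' g" using eq f g by (simp add: ab simps)
    then have "FOb L m = FOb L m'" "FOb L n = FOb L n'"
      using copair(1)[OF f] copair(1)[OF g] by (auto simp: Hom_iff)
    \<comment> \<open>Source and target of the copairing recover the two numbers because
      \<open>L\<close> is injective on objects; afterwards the components recover the
      function.\<close>
    then have mn: "m' = m" "n' = n" using Lbij by (auto simp: bij_betw_def inj_on_def)
    have "f = g"
      by (rule app_eqI[OF f g[unfolded mn]])
        (use eq in \<open>auto simp: mn simp flip: copair(2)[OF f] copair(2)[OF g[unfolded mn]]\<close>)
    then show "a = b" by (simp add: ab mn)
  qed
  moreover have "w \<in> FMor kleisli_theory_iso ` Mor ?K" if w: "w \<in> Mor T" for w
  proof -
    obtain m n where mn: "Src T w = FOb L m" "Tgt T w = FOb L n"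
      using Lbij w T_category unfolding bij_betw_def by (metis Src_Ob Tgt_Ob imageE)
    have wH: "w \<in> Hom T (FOb L m) (FOb L n)" using w mn by (simp add: Hom_iff)
    \<comment> \<open>The preimage of \<open>w\<close> is the family of its components along the
      points.\<close>
    define f where "f = arr (st m) (hom_obj n) (\<lambda>x. Comp T (FMor L (point m (inv \<nu> x))) w)"
    have f: "f \<in> Hom S (st m) (hom_obj n)"
      unfolding f_def by (rule arr_Hom) (auto simp: hom_obj intro!: Comp_Hom[OF T_category L_point wH] simp del: One_nat_def)
    have "copair m n f = w"
      by (rule copair_eqI[OF f wH]) (simp add: f_def)
    moreover have "(m, n, f) \<in> Mor ?K" using MorK f by blast
    ultimately show ?thesis
      using simps(2)[OF f] by (intro image_eqI[of _ _ "(m, n, f)"]) simp_all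
  qed
  ultimately show ?thesis
    using Lbij functor_Mor(1)[of ?K T kleisli_theory_iso]
    unfolding iso_functor_def bij_betw_def simps kleisli_simps(1) FF_simps(1) by blast
qed

lemma kleisli_theory_iso_under:
  "functor_comp FF (kleisli_functor FF S J theory_monad) kleisli_theory_iso = L"
proof (rule functor_eqI[OF functor_comp_functor[OF kleisli_functor[OF relative_monad_theory_monad]
      iso_functor_functor[OF iso_functor_kleisli_theory_iso]] L_functor])
  fix b assume "b \<in> Mor FF"
  then have b: "b \<in> Hom FF (Src FF b) (Tgt FF b)" by (simp add: Hom_iff)
  show "FMor (functor_comp FF (kleisli_functor FF S J theory_monad) kleisli_theory_iso) b = FMor L b"
    using \<open>b \<in> Mor FF\<close> Comp_Hom[OF S_category FMor_J_Hom[OF b] eta_theory_monad(1)]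
    by (simp add: kleisli_theory_iso_simps copair_J_eta[OF b] del: FF_simps(2))
qed (simp add: kleisli_theory_iso_simps)

lemma lawvere_theory_kleisli_iso:
  "\<exists>M \<Phi>. relative_monad FF S J M \<and> iso_functor (kleisli FF S J M) T \<Phi> \<and>
    functor_comp FF (kleisli_functor FF S J M) \<Phi> = L"
  using relative_monad_theory_monad iso_functor_kleisli_theory_iso kleisli_theory_iso_under by blast

end

end


section \<open>The equivalence\<close>

text \<open>Only \<open>\<Phi>\<close> is inverted, so only its source and target categories have to
  be passed as arguments.\<close>

definition conjugate ::
  "('o, 'm) cat \<Rightarrow> ('p, 'n) cat \<Rightarrow> ('o, 'm, 'p, 'n) fnct \<Rightarrow> ('r, 's, 't, 'u) fnct
     \<Rightarrow> ('o, 'm, 'r, 's) fnct \<Rightarrow> ('p, 'n, 't, 'u) fnct" where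
  "conjugate C T \<Phi> \<Phi>' G = functor_comp T (functor_inv C T \<Phi>) (functor_comp C G \<Phi>')"

lemma conjugate_functor:
  assumes "iso_functor C T \<Phi>" "iso_functor C' T' \<Phi>'" "is_functor C C' G"
  shows "is_functor T T' (conjugate C T \<Phi> \<Phi>' G)"
  unfolding conjugate_def
  by (rule functor_comp_functor[OF functor_inv_functor functor_comp_functor[OF assms(3) iso_functor_functor]])
    (use assms in auto)

text \<open>\<open>\<Phi>\<close> cancels against its inverse. Thus a functor under \<open>F\<close>
  remains one after both structure functors are carried to the copies.\<close>

lemma functor_comp_conjugate:
  assumes \<Phi>: "iso_functor C T \<Phi>" and L: "is_functor F C L" and G: "is_functor C C' G"
  shows "functor_comp F (functor_comp F L \<Phi>) (conjugate C T \<Phi> \<Phi>' G) = functor_comp F (functor_comp F L G) \<Phi>'"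
proof -
  note F = iso_functor_functor[OF \<Phi>] and I = functor_inv_functor[OF \<Phi>]
  have "functor_comp F (functor_comp F L \<Phi>) (conjugate C T \<Phi> \<Phi>' G)
      = functor_comp F (functor_comp F (functor_comp F L \<Phi>) (functor_inv C T \<Phi>)) (functor_comp C G \<Phi>')"
    unfolding conjugate_def by (rule functor_comp_assoc[OF functor_comp_functor[OF L F], symmetric])
  also have "functor_comp F (functor_comp F L \<Phi>) (functor_inv C T \<Phi>) = L"
    by (simp add: functor_comp_assoc[OF L] functor_comp_inv_right[OF \<Phi>] functor_comp_id_right[OF L])
  also have "functor_comp F L (functor_comp C G \<Phi>') = functor_comp F (functor_comp F L G) \<Phi>'"
    by (rule functor_comp_assoc[OF L, symmetric])
  finally show ?thesis .
qed

lemma conjugate_id: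
  assumes \<Phi>: "iso_functor C T \<Phi>"
  shows "conjugate C T \<Phi> \<Phi> (functor_id C) = functor_id T"
  by (simp add: conjugate_def functor_comp_id_left[OF iso_functor_functor[OF \<Phi>]] functor_comp_inv_left[OF \<Phi>])

text \<open>The inner \<open>\<Phi>'\<close> cancels against its inverse; this gives functoriality
  of the passage to copies.\<close>

lemma conjugate_comp:
  assumes \<Phi>: "iso_functor C T \<Phi>" and \<Phi>': "iso_functor C' T' \<Phi>'"
    and G: "is_functor C C' G" and H: "is_functor C' C'' H"
  shows "functor_comp T (conjugate C T \<Phi> \<Phi>' G) (conjugate C' T' \<Phi>' \<Phi>'' H) = conjugate C T \<Phi> \<Phi>'' (functor_comp C G H)"
proof -
  note I = functor_inv_functor[OF \<Phi>] and F' = iso_functor_functor[OF \<Phi>']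
  have "functor_comp T (conjugate C T \<Phi> \<Phi>' G) (conjugate C' T' \<Phi>' \<Phi>'' H)
      = functor_comp T (functor_inv C T \<Phi>)
          (functor_comp C (functor_comp C G \<Phi>') (conjugate C' T' \<Phi>' \<Phi>'' H))"
    unfolding conjugate_def[of C T] by (rule functor_comp_assoc[OF I])
  also have "\<dots> = conjugate C T \<Phi> \<Phi>'' (functor_comp C G H)"
    by (simp add: functor_comp_conjugate[OF \<Phi>' G H] conjugate_def[of C T])
  finally show ?thesis .
qed

text \<open>Undoes the conjugation by exchanging the roles of the isomorphisms and their inverses;
  needed for fullness.\<close>

lemma conjugate_inverse:
  assumes \<Phi>: "iso_functor C T \<Phi>" and \<Phi>': "iso_functor C' T' \<Phi>'" and H: "is_functor T T' H"
  shows "conjugate C T \<Phi> \<Phi>' (functor_comp C \<Phi> (functor_comp T H (functor_inv C' T' \<Phi>'))) = H"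
proof -
  note F = iso_functor_functor[OF \<Phi>] and I = functor_inv_functor[OF \<Phi>]
    and I' = functor_inv_functor[OF \<Phi>']
  have "functor_comp C (functor_comp C \<Phi> (functor_comp T H (functor_inv C' T' \<Phi>'))) \<Phi>'
     = functor_comp C \<Phi> H"
    by (simp add: functor_comp_assoc[OF F] functor_comp_assoc[OF H]
      functor_comp_inv_left[OF \<Phi>'] functor_comp_id_right[OF H])
  then show ?thesis
    by (simp add: conjugate_def functor_comp_assoc[OF I, symmetric]
      functor_comp_inv_left[OF \<Phi>] functor_comp_id_left[OF H])
qed

text \<open>Composing with \<open>\<Phi>\<close> before and the inverse of \<open>\<Phi>'\<close>
  after recovers the functor; needed for faithfulness.\<close>

lemma conjugate_inj:
  assumes \<Phi>: "iso_functor C T \<Phi>" and \<Phi>': "iso_functor C' T' \<Phi>'"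
    and G: "is_functor C C' G" and H: "is_functor C C' H" and eq: "conjugate C T \<Phi> \<Phi>' G = conjugate C T \<Phi> \<Phi>' H"
  shows "G = H"
proof -
  note F = iso_functor_functor[OF \<Phi>]
  have "functor_comp C (functor_comp C \<Phi> (conjugate C T \<Phi> \<Phi>' G)) (functor_inv C' T' \<Phi>') = G"
    if G: "is_functor C C' G" for G
    unfolding conjugate_def
    by (simp add: functor_comp_assoc[OF F, symmetric] functor_comp_inv_right[OF \<Phi>]
      functor_comp_id_left[OF functor_comp_functor[OF G iso_functor_functor[OF \<Phi>']]]
      functor_comp_assoc[OF G] functor_comp_inv_right[OF \<Phi>'] functor_comp_id_right[OF G])
  from this[OF G, unfolded eq] this[OF H] show ?thesis by (rule trans[OF sym])
qed

section \<open>The functor from monads to theories and its quasi-inverse\<close>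

lemma Hom_RMon:
  "a \<in> Hom (RMon C D J) M M' \<longleftrightarrow> relative_monad C D J M \<and> relative_monad C D J M' \<and>
    (\<exists>\<phi>. rmon_morphism C D J M M' \<phi> \<and> a = (M, M', \<phi>))"
  by (auto simp: RMon_def hom_cat_homset_cat Hom_homset_cat)

lemma RMon_simps [simp]:
  "Ob (RMon C D J) = {M. relative_monad C D J M}"
  "relative_monad C D J M \<Longrightarrow> Ident (RMon C D J) M = (M, M, \<lambda>X\<in>Ob C. Ident D (RR M X))"
  by (simp_all add: RMon_def hom_cat_homset_cat)

lemma Comp_RMon:
  "relative_monad C D J M \<Longrightarrow> relative_monad C D J M' \<Longrightarrow> relative_monad C D J M'' \<Longrightarrow>
    rmon_morphism C D J M M' \<phi> \<Longrightarrow> rmon_morphism C D J M' M'' \<psi> \<Longrightarrow>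
    Comp (RMon C D J) (M, M', \<phi>) (M', M'', \<psi>) = (M, M'', \<lambda>X\<in>Ob C. Comp D (\<phi> X) (\<psi> X))"
  unfolding RMon_def hom_cat_homset_cat by (subst homset_cat_Comp) auto

theorem mainTheorem1:
  fixes elts :: "'v \<Rightarrow> 'v set" and U :: "'v set" and \<nu> :: "nat \<Rightarrow> 'v"
  assumes "grothendieck_universe elts U"
    and "inj \<nu>" and "in_universe elts U (range \<nu>)"
  shows "\<exists>R S \<alpha> \<beta>.
    is_functor (RMon FF (Sets elts U) (Jf elts U \<nu>)) (LW elts U) R \<and>
    is_functor (LW elts U) (RMon FF (Sets elts U) (Jf elts U \<nu>)) S \<and>
    functor_iso (RMon FF (Sets elts U) (Jf elts U \<nu>)) (RMon FF (Sets elts U) (Jf elts U \<nu>))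
      (functor_comp (RMon FF (Sets elts U) (Jf elts U \<nu>)) R S)
      (functor_id (RMon FF (Sets elts U) (Jf elts U \<nu>))) \<alpha> \<and>
    functor_iso (LW elts U) (LW elts U)
      (functor_comp (LW elts U) S R) (functor_id (LW elts U)) \<beta>"
proof -
  interpret universe_nat elts U \<nu>
    by unfold_locales (use assms in auto)
  let ?C = "RMon FF S J" and ?D = "LW elts U"
  let ?K = "kleisli FF S J" and ?L = "kleisli_functor FF S J"
  \<comment> \<open>One small copy is fixed for every monad at once, since \<open>R\<close> must be
    a function on objects.\<close>
  obtain T \<Phi> where T: "\<And>M. relative_monad FF S J M \<Longrightarrow>
      iso_functor (?K M) (T M) (\<Phi> M) \<and> small (Ob (T M)) \<and> small (Mor (T M))"
    using kleisli_small_copy by metis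
  note iso = T[THEN conjunct1]
  define r where "r M = (T M, functor_comp FF (?L M) (\<Phi> M))" for M
  define c where "c M M' G = conjugate (?K M) (T M) (\<Phi> M) (\<Phi> M') G" for M M' G
  have r: "r M \<in> Ob ?D" if "relative_monad FF S J M" for M
    using T[OF that] lawvere_theory_iso_functor[OF kleisli_lawvere_theory[OF that] iso[OF that]]
    by (simp add: r_def LW_simps)
  have c: "(r M, r M', c M M' G) \<in> Hom ?D (r M) (r M')"
    if M: "relative_monad FF S J M" and M': "relative_monad FF S J M'"
      and G: "is_functor (?K M) (?K M') G" "functor_comp FF (?L M) G = ?L M'" for M M' G
    using r[OF M] r[OF M'] conjugate_functor[OF iso[OF M] iso[OF M'] G(1)]
      functor_comp_conjugate[OF iso[OF M] kleisli_functor[OF M] G(1)]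
    unfolding r_def Hom_LW c_def by (simp add: G(2))
  define R where "R = \<lparr>FOb = (\<lambda>M\<in>Ob ?C. r M),
    FMor = (\<lambda>(M, M', \<phi>)\<in>Mor ?C. (r M, r M', c M M' (kleisli_map FF S J M \<phi>)))\<rparr>"
  have RO: "FOb R M = r M" if "relative_monad FF S J M" for M
    using that by (simp add: R_def)
  have RM: "FMor R (M, M', \<phi>) = (r M, r M', c M M' (kleisli_map FF S J M \<phi>))"
    if "(M, M', \<phi>) \<in> Hom ?C M M'" for M M' \<phi>
    using that by (simp add: R_def Hom_iff)
  have MorC: "a \<in> Mor ?C \<longleftrightarrow> (\<exists>M M' \<phi>. a = (M, M', \<phi>) \<and> a \<in> Hom ?C M M' \<and> relative_monad FF S J M \<and>
      relative_monad FF S J M' \<and> rmon_morphism FF S J M M' \<phi>)" for a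
    using Hom_RMon[of a FF S J "Src ?C a" "Tgt ?C a"] by (auto simp: Hom_iff)
  have RF: "is_functor ?C ?D R"
    unfolding is_functor_def
  proof (intro conjI ballI impI)
    show "FOb R \<in> Ob ?C \<rightarrow>\<^sub>E Ob ?D" "FMor R \<in> extensional (Mor ?C)"
      using r by (auto simp: R_def)
    show "FMor R a \<in> Hom ?D (FOb R (Src ?C a)) (FOb R (Tgt ?C a))" if "a \<in> Mor ?C" for a
    proof -
      obtain M M' \<phi> where a: "a = (M, M', \<phi>)" "a \<in> Hom ?C M M'"
        and M: "relative_monad FF S J M" and M': "relative_monad FF S J M'" and p: "rmon_morphism FF S J M M' \<phi>"
        using \<open>a \<in> Mor ?C\<close> unfolding MorC by blast
      have "Src ?C a = M" "Tgt ?C a = M'" using a(2) by (simp_all add: Hom_iff)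
      then show ?thesis
        using c[OF M M' kleisli_map_functor[OF M M' p] kleisli_map_under[OF M M' p]] RM a
        by (simp add: RO[OF M] RO[OF M'])
    qed
    show "FMor R (Ident ?C M) = Ident ?D (FOb R M)" if "M \<in> Ob ?C" for M
    proof -
      have M: "relative_monad FF S J M" using that by simp
      have "(M, M, \<lambda>X\<in>Ob FF. Ident S (RR M X)) \<in> Hom ?C M M"
        using M rmon_morphism_Ident[OF M] by (auto simp: Hom_RMon)
      then show ?thesis
        using r[OF M] RM[of M M] unfolding r_def
        by (simp add: M RO r_def LW_simps(2) kleisli_map_Ident[OF M, simplified] c_def conjugate_id[OF iso[OF M]])
    qed
    show "FMor R (Comp ?C a b) = Comp ?D (FMor R a) (FMor R b)"
      if prems: "a \<in> Mor ?C" "b \<in> Mor ?C" "Tgt ?C a = Src ?C b" for a b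
    proof -
      obtain M M' M'' \<phi> \<psi> where ab: "a = (M, M', \<phi>)" "b = (M', M'', \<psi>)"
        and aH: "a \<in> Hom ?C M M'" and bH: "b \<in> Hom ?C M' M''"
        and M: "relative_monad FF S J M" and M': "relative_monad FF S J M'" and M'': "relative_monad FF S J M''"
        and p: "rmon_morphism FF S J M M' \<phi>" and q: "rmon_morphism FF S J M' M'' \<psi>"
        using prems unfolding MorC by (auto simp: Hom_iff)
      have "Comp ?C a b \<in> Hom ?C M M''" by (rule Comp_Hom[OF RMon_category aH bH])
      then have "FMor R (Comp ?C a b)
          = (r M, r M'', c M M'' (functor_comp (?K M) (kleisli_map FF S J M \<phi>) (kleisli_map FF S J M' \<psi>)))"
        unfolding ab Comp_RMon[OF M M' M'' p q] by (simp only: RM kleisli_map_Comp[OF M p q])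
      also have "\<dots> = Comp ?D (r M, r M', c M M' (kleisli_map FF S J M \<phi>)) (r M', r M'', c M' M'' (kleisli_map FF S J M' \<psi>))"
        using c[OF M M' kleisli_map_functor[OF M M' p] kleisli_map_under[OF M M' p]]
          c[OF M' M'' kleisli_map_functor[OF M' M'' q] kleisli_map_under[OF M' M'' q]]
        unfolding r_def Hom_LW
        by (simp add: Comp_LW c_def conjugate_comp[OF iso[OF M] iso[OF M'] kleisli_map_functor[OF M M' p]
              kleisli_map_functor[OF M' M'' q]])
      also have "\<dots> = Comp ?D (FMor R a) (FMor R b)"
        using aH bH by (simp add: ab RM)
      finally show ?thesis .
    qed
  qed (simp_all add: RMon_category LW_category)
  have "\<exists>S' \<alpha> \<beta>. is_functor ?D ?C S' \<and> functor_iso ?C ?C (functor_comp ?C R S') (functor_id ?C) \<alpha> \<and>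
    functor_iso ?D ?D (functor_comp ?D S' R) (functor_id ?D) \<beta>"
  proof (rule equivalence_if_fully_faithful_essentially_surjective[OF RF])
    fix M M' g assume "M \<in> Ob ?C" "M' \<in> Ob ?C" and g: "g \<in> Hom ?D (FOb R M) (FOb R M')"
    then have M: "relative_monad FF S J M" and M': "relative_monad FF S J M'" by auto
    obtain H where H: "is_functor (T M) (T M') H" "g = (r M, r M', H)"
      and under: "functor_comp FF (functor_comp FF (?L M) (\<Phi> M)) H = functor_comp FF (?L M') (\<Phi> M')"
      using g unfolding RO[OF M] RO[OF M'] r_def Hom_LW by blast
    \<comment> \<open>A morphism between the copies is pulled back to the Kleisli categories, so
      that fullness there applies.\<close>
    define G where "G = functor_comp (?K M) (\<Phi> M) (functor_comp (T M) H (functor_inv (?K M') (T M') (\<Phi> M')))"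
    note F = iso_functor_functor[OF iso[OF M]] and F' = iso_functor_functor[OF iso[OF M']]
    note I' = functor_inv_functor[OF iso[OF M']]
    have G: "is_functor (?K M) (?K M') G"
      unfolding G_def by (intro functor_comp_functor[OF F functor_comp_functor[OF H(1) I']])
    have "functor_comp FF (?L M) G = functor_comp FF (functor_comp FF (functor_comp FF (?L M) (\<Phi> M)) H)
        (functor_inv (?K M') (T M') (\<Phi> M'))"
      unfolding G_def
      by (simp add: functor_comp_assoc[OF functor_comp_functor[OF kleisli_functor[OF M] F]]
          functor_comp_assoc[OF kleisli_functor[OF M]] functor_comp_assoc[OF F])
    also have "\<dots> = ?L M'"
      unfolding under by (simp add: functor_comp_assoc[OF kleisli_functor[OF M']]
        functor_comp_inv_right[OF iso[OF M']] functor_comp_id_right[OF kleisli_functor[OF M']])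
    finally obtain \<phi> where \<phi>: "rmon_morphism FF S J M M' \<phi>" "kleisli_map FF S J M \<phi> = G"
      using kleisli_map_full[OF M M' G] by blast
    have h: "(M, M', \<phi>) \<in> Hom ?C M M'" using M M' \<phi> by (simp add: Hom_RMon)
    have "FMor R (M, M', \<phi>) = g"
      unfolding RM[OF h] \<phi>(2) H(2) c_def G_def conjugate_inverse[OF iso[OF M] iso[OF M'] H(1)] ..
    then show "\<exists>a \<in> Hom ?C M M'. FMor R a = g" using h by blast
  next
    fix M M' a b assume ab: "a \<in> Hom ?C M M'" "b \<in> Hom ?C M M'" "FMor R a = FMor R b"
    then obtain \<phi> \<psi> where a: "a = (M, M', \<phi>)" "rmon_morphism FF S J M M' \<phi>"
      and b: "b = (M, M', \<psi>)" "rmon_morphism FF S J M M' \<psi>"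
      and M: "relative_monad FF S J M" and M': "relative_monad FF S J M'"
      unfolding Hom_RMon by blast
    have "c M M' (kleisli_map FF S J M \<phi>) = c M M' (kleisli_map FF S J M \<psi>)"
      using ab unfolding a b by (simp add: RM)
    then have "kleisli_map FF S J M \<phi> = kleisli_map FF S J M \<psi>"
      unfolding c_def
      by (rule conjugate_inj[OF iso[OF M] iso[OF M'] kleisli_map_functor[OF M M' a(2)] kleisli_map_functor[OF M M' b(2)]])
    then show "a = b" using kleisli_map_faithful[OF M M' a(2) b(2)] by (simp add: a b)
  next
    fix Y assume "Y \<in> Ob ?D"
    moreover obtain T' L' where Y: "Y = (T', L')" by (cases Y)
    ultimately have YD: "(T', L') \<in> Ob ?D" and T': "lawvere_theory T' L'" "small (Mor T')"
      by (auto simp: LW_simps)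
    obtain M \<Psi> where M: "relative_monad FF S J M" and \<Psi>: "iso_functor (?K M) T' \<Psi>"
      and under: "functor_comp FF (?L M) \<Psi> = L'"
      using lawvere_theory_kleisli_iso[OF T'] by blast
    note K = kleisli_functor[OF M] and id = functor_id_functor[OF kleisli_category[OF M]]
    \<comment> \<open>Both \<open>T M\<close> and \<open>T'\<close> are copies of the Kleisli
      category of \<open>M\<close>. Conjugating its identity functor by the two identifications
      gives mutually inverse functors, which are morphisms of theories because \<open>L'\<close> is
      the structure functor followed by \<open>\<Psi>\<close>.\<close>
    let ?p = "conjugate (?K M) (T M) (\<Phi> M) \<Psi> (functor_id (?K M))"
    let ?q = "conjugate (?K M) T' \<Psi> (\<Phi> M) (functor_id (?K M))"
    have p: "is_functor (T M) T' ?p" "functor_comp FF (functor_comp FF (?L M) (\<Phi> M)) ?p = L'"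
      using conjugate_functor[OF iso[OF M] \<Psi> id] functor_comp_conjugate[OF iso[OF M] K id, of \<Psi>]
      by (simp_all add: functor_comp_id_right[OF K] under)
    have q: "is_functor T' (T M) ?q" "functor_comp FF L' ?q = functor_comp FF (?L M) (\<Phi> M)"
      using conjugate_functor[OF \<Psi> iso[OF M] id] functor_comp_conjugate[OF \<Psi> K id, of "\<Phi> M"]
      by (simp_all add: functor_comp_id_right[OF K] under)
    have pq: "functor_comp (T M) ?p ?q = functor_id (T M)" "functor_comp T' ?q ?p = functor_id T'"
      using conjugate_comp[OF iso[OF M] \<Psi> id id, of "\<Phi> M"] conjugate_comp[OF \<Psi> iso[OF M] id id, of \<Psi>]
      by (simp_all add: functor_comp_id_right[OF id] conjugate_id iso[OF M] \<Psi>)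
    show "\<exists>X\<in>Ob ?C. \<exists>p\<in>Hom ?D (FOb R X) Y. \<exists>q\<in>Hom ?D Y (FOb R X).
      Comp ?D p q = Ident ?D (FOb R X) \<and> Comp ?D q p = Ident ?D Y"
    proof (intro bexI conjI)
      note rM = r[OF M, unfolded r_def]
      show "M \<in> Ob ?C" using M by simp
      show "(r M, Y, ?p) \<in> Hom ?D (FOb R M) Y" "(Y, r M, ?q) \<in> Hom ?D Y (FOb R M)"
        using p q rM YD by (simp_all add: RO[OF M] r_def Y Hom_LW)
      show "Comp ?D (r M, Y, ?p) (Y, r M, ?q) = Ident ?D (FOb R M)"
        "Comp ?D (Y, r M, ?q) (r M, Y, ?p) = Ident ?D Y"
        using p q rM YD pq by (simp_all add: RO[OF M] r_def Y Comp_LW LW_simps(2))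
    qed
  qed
  then show ?thesis using RF by blast
qed

end
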